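(* Let $\mathbb{K}$ be a field. Let $\tilde{*}$ denote the generating binary operation of the operad $NAP$ over $\mathbb{K}$. The symmetrization $x\,\tilde{*}\,y+y\,\tilde{*}\,x$ induces a morphism of operads $ComMag\to NAP$ (sending the generating commutative operation $x\cdot y$ to $x\,\tilde{*}\,y+y\,\tilde{*}\,x$), and this morphism is injective.
   Context: All vector spaces and operads are over a field $\mathbb{K}$. An algebraic operad is a functor $\mathcal{O}$ from finite sets (with bijections) to vector spaces, with $\mathcal{O}(n)=\mathcal{O}[\{1,\dots,n\}]$ a module over the symmetric group $\mathbb{S}_n$, whose associated endofunctor $\mathcal{O}(V)=\bigoplus_{n\ge 1}\mathcal{O}(n)\otimes_{\mathbb{S}_n}V^{\otimes n}$ carries a monoid structure. A type of algebras determines an operad via its free algebra functor; $\mathcal{O}(n)$ is the space of multilinear $n$-ary operations. A morphism of operads $\mathcal{O}\to\mathcal{O}'$ is injective if the linear maps $\mathcal{O}(n)\to\mathcal{O}'(n)$ are injective for all $n\ge 1$. A $NAP$-algebra (NonAssociative Perm) is a vector space with a bilinear operation $\tilde{*}$ such that $(x\,\tilde{*}\,y)\,\tilde{*}\,z=(x\,\tilde{*}\,z)\,\tilde{*}\,y$ for all $x,y,z$; $NAP$ is the operad encoding these algebras. It admits the following known description: for a finite set $S$, $NAP[S]$ is the vector space with basis the (non-planar) rooted trees with vertices labelled bijectively by $S$, and for trees $T,Y$ labelled by disjoint sets, $T\,\tilde{*}\,Y$ is the tree obtained by joining the root of $Y$ to the root of $T$ by an edge, the root of the result being the root of $T$.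 A $ComMag$-algebra is a vector space $A$ with a bilinear operation $\cdot$ satisfying only $x\cdot y=y\cdot x$ for all $x,y\in A$ (no associativity); $ComMag$ is the operad encoding these algebras. *)

theory Defs
  imports Complex_Main "HOL-Library.Poly_Mapping"
begin

section \<open>Operads\<close>

text \<open>
  A (symmetric, unital) operad is a functor from finite nonempty sets and bijections to
  vector spaces, with a monoid structure for the substitution product. Labels range over
  the finite nonempty sets of natural numbers, which contain \<open>{1..n}\<close> and represent every
  finite nonempty set up to bijection; there is no arity zero, since
  the associated endofunctor is a sum over \<open>n \<ge> 1\<close>. The monoid structure is given by its
  partial compositions \<open>x \<circ>\<^sub>s y\<close>, which plug \<open>y\<close> into the input \<open>s\<close> of \<open>x\<close>.

  The spaces \<open>O[S]\<close> are subspaces of one ambient vector space. Nothing is assumed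
  about the relative position of the subspaces for different \<open>S\<close>, and all structure maps
  carry their label sets as arguments, so an arbitrary operad takes this form after
  passing to the direct sum of its components.
\<close>

record ('k, 'v) operad_data =
  scal :: "'k \<Rightarrow> 'v \<Rightarrow> 'v"
  comps :: "nat set \<Rightarrow> 'v set"
  relabel :: "nat set \<Rightarrow> (nat \<Rightarrow> nat) \<Rightarrow> 'v \<Rightarrow> 'v"
    \<comment> \<open>\<open>relabel P S \<sigma> : O[S] \<rightarrow> O[\<sigma> ` S]\<close>, the action of the bijection \<open>\<sigma> : S \<rightarrow> \<sigma> ` S\<close>\<close>
  pcomp :: "nat set \<Rightarrow> nat \<Rightarrow> nat set \<Rightarrow> 'v \<Rightarrow> 'v \<Rightarrow> 'v"
    \<comment> \<open>\<open>pcomp P S s T : O[S] \<times> O[T] \<rightarrow> O[(S - {s}) \<union> T]\<close>\<close>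
  unt :: "nat \<Rightarrow> 'v"
    \<comment> \<open>\<open>unt P s \<in> O[{s}]\<close>, the identity operation\<close>

definition labels :: "nat set \<Rightarrow> bool" where
  "labels S \<longleftrightarrow> finite S \<and> S \<noteq> {}"

definition pluggable :: "nat set \<Rightarrow> nat \<Rightarrow> nat set \<Rightarrow> bool" where
  "pluggable S s T \<longleftrightarrow> labels S \<and> labels T \<and> s \<in> S \<and> (S - {s}) \<inter> T = {}"

locale operad = vector_space "scal P"
  for P :: "('k::field, 'v::ab_group_add) operad_data" +
  assumes comps_subspace: "labels S \<Longrightarrow> subspace (comps P S)"
    and relabel_closed:
      "\<lbrakk>labels S; inj_on \<sigma> S; x \<in> comps P S\<rbrakk> \<Longrightarrow> relabel P S \<sigma> x \<in> comps P (\<sigma> ` S)"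
    and relabel_add:
      "\<lbrakk>labels S; inj_on \<sigma> S; x \<in> comps P S; y \<in> comps P S\<rbrakk>
        \<Longrightarrow> relabel P S \<sigma> (x + y) = relabel P S \<sigma> x + relabel P S \<sigma> y"
    and relabel_scal:
      "\<lbrakk>labels S; inj_on \<sigma> S; x \<in> comps P S\<rbrakk>
        \<Longrightarrow> relabel P S \<sigma> (scal P c x) = scal P c (relabel P S \<sigma> x)"
    and relabel_cong:
      "\<lbrakk>labels S; inj_on \<sigma> S; \<And>s. s \<in> S \<Longrightarrow> \<sigma> s = \<tau> s; x \<in> comps P S\<rbrakk>
        \<Longrightarrow> relabel P S \<sigma> x = relabel P S \<tau> x"
    and relabel_id: "\<lbrakk>labels S; x \<in> comps P S\<rbrakk> \<Longrightarrow> relabel P S id x = x"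
    and relabel_comp:
      "\<lbrakk>labels S; inj_on \<sigma> S; inj_on \<tau> (\<sigma> ` S); x \<in> comps P S\<rbrakk>
        \<Longrightarrow> relabel P S (\<tau> \<circ> \<sigma>) x = relabel P (\<sigma> ` S) \<tau> (relabel P S \<sigma> x)"
    and pcomp_closed:
      "\<lbrakk>pluggable S s T; x \<in> comps P S; y \<in> comps P T\<rbrakk>
        \<Longrightarrow> pcomp P S s T x y \<in> comps P ((S - {s}) \<union> T)"
    and pcomp_add_left:
      "\<lbrakk>pluggable S s T; x \<in> comps P S; x' \<in> comps P S; y \<in> comps P T\<rbrakk>
        \<Longrightarrow> pcomp P S s T (x + x') y = pcomp P S s T x y + pcomp P S s T x' y"
    and pcomp_scal_left:
      "\<lbrakk>pluggable S s T; x \<in> comps P S; y \<in> comps P T\<rbrakk>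
        \<Longrightarrow> pcomp P S s T (scal P c x) y = scal P c (pcomp P S s T x y)"
    and pcomp_add_right:
      "\<lbrakk>pluggable S s T; x \<in> comps P S; y \<in> comps P T; y' \<in> comps P T\<rbrakk>
        \<Longrightarrow> pcomp P S s T x (y + y') = pcomp P S s T x y + pcomp P S s T x y'"
    and pcomp_scal_right:
      "\<lbrakk>pluggable S s T; x \<in> comps P S; y \<in> comps P T\<rbrakk>
        \<Longrightarrow> pcomp P S s T x (scal P c y) = scal P c (pcomp P S s T x y)"
    and pcomp_natural:
      "\<lbrakk>pluggable S s T; inj_on \<sigma> S; inj_on \<tau> T; \<sigma> ` (S - {s}) \<inter> \<tau> ` T = {};
        x \<in> comps P S; y \<in> comps P T\<rbrakk>
        \<Longrightarrow> relabel P ((S - {s}) \<union> T) (\<lambda>u. if u \<in> T then \<tau> u else \<sigma> u) (pcomp P S s T x y)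
            = pcomp P (\<sigma> ` S) (\<sigma> s) (\<tau> ` T) (relabel P S \<sigma> x) (relabel P T \<tau> y)"
    and pcomp_sequential:
      "\<lbrakk>pluggable S s T; pluggable T t U; (S - {s}) \<inter> U = {};
        x \<in> comps P S; y \<in> comps P T; z \<in> comps P U\<rbrakk>
        \<Longrightarrow> pcomp P ((S - {s}) \<union> T) t U (pcomp P S s T x y) z
            = pcomp P S s ((T - {t}) \<union> U) x (pcomp P T t U y z)"
    and pcomp_parallel:
      "\<lbrakk>pluggable S s T; pluggable S s' U; s \<noteq> s'; T \<inter> U = {};
        x \<in> comps P S; y \<in> comps P T; z \<in> comps P U\<rbrakk>
        \<Longrightarrow> pcomp P ((S - {s}) \<union> T) s' U (pcomp P S s T x y) z
            = pcomp P ((S - {s'}) \<union> U) s T (pcomp P S s' U x z) y"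
    and unt_closed: "unt P s \<in> comps P {s}"
    and unt_natural: "relabel P {s} \<sigma> (unt P s) = unt P (\<sigma> s)"
    and unt_left:
      "\<lbrakk>labels T; y \<in> comps P T\<rbrakk> \<Longrightarrow> pcomp P {s} s T (unt P s) y = y"
    and unt_right:
      "\<lbrakk>labels S; s \<in> S; x \<in> comps P S\<rbrakk> \<Longrightarrow> pcomp P S s {s} x (unt P s) = x"

locale operad_morphism = P: operad P + Q: operad Q
  for P :: "('k::field, 'v::ab_group_add) operad_data"
    and Q :: "('k, 'w::ab_group_add) operad_data"
    and \<phi> :: "nat set \<Rightarrow> 'v \<Rightarrow> 'w" +
  assumes closed: "\<lbrakk>labels S; x \<in> comps P S\<rbrakk> \<Longrightarrow> \<phi> S x \<in> comps Q S"
    and add: "\<lbrakk>labels S; x \<in> comps P S; y \<in> comps P S\<rbrakk> \<Longrightarrow> \<phi> S (x + y) = \<phi> S x + \<phi> S y"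
    and scal: "\<lbrakk>labels S; x \<in> comps P S\<rbrakk> \<Longrightarrow> \<phi> S (scal P c x) = scal Q c (\<phi> S x)"
    and relabel:
      "\<lbrakk>labels S; inj_on \<sigma> S; x \<in> comps P S\<rbrakk>
        \<Longrightarrow> \<phi> (\<sigma> ` S) (relabel P S \<sigma> x) = relabel Q S \<sigma> (\<phi> S x)"
    and pcomp:
      "\<lbrakk>pluggable S s T; x \<in> comps P S; y \<in> comps P T\<rbrakk>
        \<Longrightarrow> \<phi> ((S - {s}) \<union> T) (pcomp P S s T x y) = pcomp Q S s T (\<phi> S x) (\<phi> T y)"
    and unt: "\<phi> {s} (unt P s) = unt Q s"

definition injective_on_operad ::
  "('k, 'v) operad_data \<Rightarrow> (nat set \<Rightarrow> 'v \<Rightarrow> 'w) \<Rightarrow> bool" where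
  "injective_on_operad P \<phi> \<longleftrightarrow> (\<forall>n::nat. 1 \<le> n \<longrightarrow> inj_on (\<phi> {1..n}) (comps P {1..n}))"


section \<open>Free nonassociative algebras\<close>

datatype 'x mag = Gen 'x | Prod "'x mag" "'x mag"

primrec leaves :: "'x mag \<Rightarrow> 'x list" where
  "leaves (Gen x) = [x]"
| "leaves (Prod s t) = leaves s @ leaves t"

text \<open>
  The type \<open>'x mag \<Rightarrow>\<^sub>0 'k\<close> of finitely supported functions is the free \<open>'k\<close>-algebra with one
  bilinear operation on the generators \<open>'x\<close>; bracketed monomials form its basis.
\<close>

definition fm_scale :: "'k::field \<Rightarrow> ('x mag \<Rightarrow>\<^sub>0 'k) \<Rightarrow> ('x mag \<Rightarrow>\<^sub>0 'k)" where
  "fm_scale c f = Poly_Mapping.map ((*) c) f"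

definition fm_gen :: "'x \<Rightarrow> ('x mag \<Rightarrow>\<^sub>0 'k::field)" where
  "fm_gen x = Poly_Mapping.single (Gen x) 1"

definition fm_mult :: "('x mag \<Rightarrow>\<^sub>0 'k::field) \<Rightarrow> ('x mag \<Rightarrow>\<^sub>0 'k) \<Rightarrow> ('x mag \<Rightarrow>\<^sub>0 'k)" where
  "fm_mult f g = (\<Sum>s\<in>Poly_Mapping.keys f. \<Sum>t\<in>Poly_Mapping.keys g.
     Poly_Mapping.single (Prod s t) (Poly_Mapping.lookup f s * Poly_Mapping.lookup g t))"

primrec fm_eval :: "('x \<Rightarrow> ('y mag \<Rightarrow>\<^sub>0 'k::field)) \<Rightarrow> 'x mag \<Rightarrow> ('y mag \<Rightarrow>\<^sub>0 'k)" where
  "fm_eval \<theta> (Gen x) = \<theta> x"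
| "fm_eval \<theta> (Prod s t) = fm_mult (fm_eval \<theta> s) (fm_eval \<theta> t)"

text \<open>The algebra homomorphism sending each generator \<open>x\<close> to \<open>\<theta> x\<close>.\<close>

definition fm_bind ::
  "('x \<Rightarrow> ('y mag \<Rightarrow>\<^sub>0 'k::field)) \<Rightarrow> ('x mag \<Rightarrow>\<^sub>0 'k) \<Rightarrow> ('y mag \<Rightarrow>\<^sub>0 'k)" where
  "fm_bind \<theta> f =
     (\<Sum>t\<in>Poly_Mapping.keys f. fm_scale (Poly_Mapping.lookup f t) (fm_eval \<theta> t))"

text \<open>Multilinear elements: each label in \<open>S\<close>, and no other, occurs exactly once in every monomial.\<close>

definition fm_multilinear :: "'x set \<Rightarrow> ('x mag \<Rightarrow>\<^sub>0 'k::field) set" where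
  "fm_multilinear S =
     {f. \<forall>t\<in>Poly_Mapping.keys f. distinct (leaves t) \<and> set (leaves t) = S}"

text \<open>The two-sided ideal generated by a set.\<close>

inductive_set fm_ideal :: "('x mag \<Rightarrow>\<^sub>0 'k::field) set \<Rightarrow> ('x mag \<Rightarrow>\<^sub>0 'k) set"
  for G :: "('x mag \<Rightarrow>\<^sub>0 'k) set" where
  fm_ideal_gen: "g \<in> G \<Longrightarrow> g \<in> fm_ideal G"
| fm_ideal_zero: "0 \<in> fm_ideal G"
| fm_ideal_add: "f \<in> fm_ideal G \<Longrightarrow> g \<in> fm_ideal G \<Longrightarrow> f + g \<in> fm_ideal G"
| fm_ideal_scale: "f \<in> fm_ideal G \<Longrightarrow> fm_scale c f \<in> fm_ideal G"
| fm_ideal_mult_left: "f \<in> fm_ideal G \<Longrightarrow> fm_mult h f \<in> fm_ideal G"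
| fm_ideal_mult_right: "f \<in> fm_ideal G \<Longrightarrow> fm_mult f h \<in> fm_ideal G"

definition commag_ideal :: "('x mag \<Rightarrow>\<^sub>0 'k::field) set" where
  "commag_ideal = fm_ideal {fm_mult x y - fm_mult y x | x y. True}"

definition nap_ideal :: "('x mag \<Rightarrow>\<^sub>0 'k::field) set" where
  "nap_ideal = fm_ideal
     {fm_mult (fm_mult x y) z - fm_mult (fm_mult x z) y | x y z. True}"

subsection \<open>Auxiliary facts\<close>

lemma lookup_fm_scale [simp]:
  "Poly_Mapping.lookup (fm_scale c f) t = c * Poly_Mapping.lookup f t"
  unfolding fm_scale_def by (simp add: Poly_Mapping.map.rep_eq when_def)

lemma lookup_fm_mult:
  "Poly_Mapping.lookup (fm_mult f g) u =
     (case u of Gen x \<Rightarrow> 0 | Prod s t \<Rightarrow> Poly_Mapping.lookup f s * Poly_Mapping.lookup g t)"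
proof (cases u)
  case (Gen x)
  then show ?thesis
    by (simp add: fm_mult_def lookup_sum lookup_single)
next
  case (Prod a b)
  have "Poly_Mapping.lookup (fm_mult f g) u =
      (\<Sum>s\<in>Poly_Mapping.keys f. \<Sum>t\<in>Poly_Mapping.keys g.
        if t = b then (if s = a then Poly_Mapping.lookup f s * Poly_Mapping.lookup g t else 0) else 0)"
    unfolding fm_mult_def lookup_sum
    by (intro sum.cong refl) (auto simp: lookup_single when_def Prod)
  also have "\<dots> = (\<Sum>s\<in>Poly_Mapping.keys f.
      if s = a then Poly_Mapping.lookup f s * Poly_Mapping.lookup g b else 0)"
    by (intro sum.cong refl) (auto simp: in_keys_iff)
  also have "\<dots> = Poly_Mapping.lookup f a * Poly_Mapping.lookup g b"
    by (simp add: in_keys_iff)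
  finally show ?thesis
    by (simp add: Prod)
qed

lemma vector_space_fm_scale: "vector_space (fm_scale :: 'k::field \<Rightarrow> ('x mag \<Rightarrow>\<^sub>0 'k) \<Rightarrow> _)"
  by unfold_locales (auto intro!: poly_mapping_eqI simp: lookup_add algebra_simps)

interpretation fm: vector_space "fm_scale :: 'k::field \<Rightarrow> ('x mag \<Rightarrow>\<^sub>0 'k) \<Rightarrow> _"
  by (rule vector_space_fm_scale)

lemma fm_mult_add_left: "fm_mult (f + f') g = fm_mult f g + fm_mult f' g"
  and fm_mult_add_right: "fm_mult f (g + g') = fm_mult f g + fm_mult f g'"
  and fm_mult_diff_left: "fm_mult (f - f') g = fm_mult f g - fm_mult f' g"
  and fm_mult_diff_right: "fm_mult f (g - g') = fm_mult f g - fm_mult f g'"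
  and fm_mult_scale_left: "fm_mult (fm_scale c f) g = fm_scale c (fm_mult f g)"
  and fm_mult_scale_right: "fm_mult f (fm_scale c g) = fm_scale c (fm_mult f g)"
  by (auto intro!: poly_mapping_eqI
      simp: lookup_fm_mult lookup_add lookup_minus algebra_simps split: mag.splits)

lemma fm_bind_superset:
  assumes "finite A" "Poly_Mapping.keys f \<subseteq> A"
  shows "fm_bind \<theta> f = (\<Sum>t\<in>A. fm_scale (Poly_Mapping.lookup f t) (fm_eval \<theta> t))"
  unfolding fm_bind_def
  by (rule sum.mono_neutral_left) (use assms in \<open>auto simp: in_keys_iff\<close>)

lemma fm_bind_add: "fm_bind \<theta> (f + g) = fm_bind \<theta> f + fm_bind \<theta> g"
proof -
  let ?A = "Poly_Mapping.keys f \<union> Poly_Mapping.keys g"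
  have "Poly_Mapping.keys (f + g) \<subseteq> ?A"
    by (rule keys_add)
  then show ?thesis
    by (simp add: fm_bind_superset[of ?A] lookup_add fm.scale_left_distrib sum.distrib)
qed

lemma fm_bind_scale: "fm_bind \<theta> (fm_scale c f) = fm_scale c (fm_bind \<theta> f)"
proof -
  have "Poly_Mapping.keys (fm_scale c f) \<subseteq> Poly_Mapping.keys f"
    by (auto simp: in_keys_iff)
  then show ?thesis
    by (simp add: fm_bind_superset[of "Poly_Mapping.keys f"] fm.scale_sum_right)
qed

lemma fm_bind_zero [simp]: "fm_bind \<theta> 0 = 0"
  by (simp add: fm_bind_def)

lemma fm_bind_diff: "fm_bind \<theta> (f - g) = fm_bind \<theta> f - fm_bind \<theta> g"
  using fm_bind_add[of \<theta> "f - g" g] by simp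

lemma fm_bind_sum: "fm_bind \<theta> (sum h A) = (\<Sum>a\<in>A. fm_bind \<theta> (h a))"
  by (induction A rule: infinite_finite_induct) (auto simp: fm_bind_add)

lemma fm_bind_single [simp]:
  "fm_bind \<theta> (Poly_Mapping.single t c) = fm_scale c (fm_eval \<theta> t)"
  by (simp add: fm_bind_def)

lemma fm_expand: "f = (\<Sum>t\<in>Poly_Mapping.keys f. Poly_Mapping.single t (Poly_Mapping.lookup f t))"
  by (rule poly_mapping_eqI)
     (simp add: lookup_sum lookup_single when_def in_keys_iff)

lemma fm_mult_zero [simp]: "fm_mult 0 g = 0" "fm_mult f 0 = 0"
  by (auto simp: fm_mult_def)

lemma fm_mult_sum_left: "fm_mult (sum h A) g = (\<Sum>a\<in>A. fm_mult (h a) g)"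
  by (induction A rule: infinite_finite_induct) (auto simp: fm_mult_add_left)

lemma fm_mult_sum_right: "fm_mult f (sum h A) = (\<Sum>a\<in>A. fm_mult f (h a))"
  by (induction A rule: infinite_finite_induct) (auto simp: fm_mult_add_right)

lemma fm_bind_mult: "fm_bind \<theta> (fm_mult f g) = fm_mult (fm_bind \<theta> f) (fm_bind \<theta> g)"
proof -
  have "fm_bind \<theta> (fm_mult f g) =
      (\<Sum>s\<in>Poly_Mapping.keys f. \<Sum>t\<in>Poly_Mapping.keys g.
        fm_scale (Poly_Mapping.lookup f s * Poly_Mapping.lookup g t)
          (fm_mult (fm_eval \<theta> s) (fm_eval \<theta> t)))"
    by (simp add: fm_mult_def[of f g] fm_bind_sum)
  also have "\<dots> = fm_mult (fm_bind \<theta> f) (fm_bind \<theta> g)"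
    unfolding fm_bind_def fm_mult_sum_left fm_mult_sum_right fm_mult_scale_left fm_mult_scale_right
    by (subst sum.swap) (simp add: fm.scale_sum_right mult.commute)
  finally show ?thesis .
qed

lemma fm_ideal_uminus: "f \<in> fm_ideal G \<Longrightarrow> - f \<in> fm_ideal G"
  using fm_ideal_scale[of f G "-1"] by simp

lemma fm_ideal_diff: "f \<in> fm_ideal G \<Longrightarrow> g \<in> fm_ideal G \<Longrightarrow> f - g \<in> fm_ideal G"
  using fm_ideal_add[OF _ fm_ideal_uminus, of f G g] by simp

lemma fm_ideal_sum: "(\<And>a. a \<in> A \<Longrightarrow> h a \<in> fm_ideal G) \<Longrightarrow> sum h A \<in> fm_ideal G"
  by (induction A rule: infinite_finite_induct) (auto intro: fm_ideal_zero fm_ideal_add)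

lemma fm_ideal_equivp: "equivp (\<lambda>f g. f - g \<in> fm_ideal G)"
proof (rule equivpI)
  show "reflp (\<lambda>f g. f - g \<in> fm_ideal G)"
    by (auto simp: reflp_def fm_ideal_zero)
  show "symp (\<lambda>f g. f - g \<in> fm_ideal G)"
    by (auto simp: symp_def dest: fm_ideal_uminus)
  show "transp (\<lambda>f g. f - g \<in> fm_ideal G)"
  proof (rule transpI)
    fix f g h
    assume "f - g \<in> fm_ideal G" "g - h \<in> fm_ideal G"
    then show "f - h \<in> fm_ideal G"
      using fm_ideal_add[of "f - g" G "g - h"] by simp
  qed
qed

lemma fm_ideal_cong_add:
  assumes "f - f' \<in> fm_ideal G" "g - g' \<in> fm_ideal G"
  shows "(f + g) - (f' + g') \<in> fm_ideal G"
  using fm_ideal_add[OF assms] by (simp add: algebra_simps)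

lemma fm_ideal_cong_diff:
  assumes "f - f' \<in> fm_ideal G" "g - g' \<in> fm_ideal G"
  shows "(f - g) - (f' - g') \<in> fm_ideal G"
  using fm_ideal_diff[OF assms] by (simp add: algebra_simps)

lemma fm_ideal_cong_uminus:
  assumes "f - f' \<in> fm_ideal G"
  shows "(- f) - (- f') \<in> fm_ideal G"
  using fm_ideal_uminus[OF assms] by (simp add: algebra_simps)

lemma fm_ideal_cong_scale:
  assumes "f - f' \<in> fm_ideal G"
  shows "fm_scale c f - fm_scale c f' \<in> fm_ideal G"
  using fm_ideal_scale[OF assms, of c] by (simp add: fm.scale_right_diff_distrib)

lemma fm_ideal_cong_mult:
  assumes "f - f' \<in> fm_ideal G" "g - g' \<in> fm_ideal G"
  shows "fm_mult f g - fm_mult f' g' \<in> fm_ideal G"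
  using fm_ideal_add[OF fm_ideal_mult_right[OF assms(1), of g] fm_ideal_mult_left[OF assms(2), of f']]
  by (simp add: fm_mult_diff_left fm_mult_diff_right)

lemma fm_ideal_cong_eval:
  assumes "\<And>x. \<theta> x - \<theta>' x \<in> fm_ideal G"
  shows "fm_eval \<theta> t - fm_eval \<theta>' t \<in> fm_ideal G"
  by (induction t) (auto intro: assms fm_ideal_cong_mult)

lemma fm_bind_ideal:
  assumes "\<And>g. g \<in> G \<Longrightarrow> fm_bind \<theta> g \<in> fm_ideal G'" and "f \<in> fm_ideal G"
  shows "fm_bind \<theta> f \<in> fm_ideal G'"
  using assms(2)
  by induction (auto simp: fm_bind_add fm_bind_scale fm_bind_mult
      intro: assms(1) fm_ideal_zero fm_ideal_add fm_ideal_scale fm_ideal_mult_left fm_ideal_mult_right)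

lemma fm_ideal_cong_bind:
  assumes "\<And>\<theta> g. g \<in> G \<Longrightarrow> fm_bind \<theta> g \<in> fm_ideal G'"
    and "\<And>x. \<theta> x - \<theta>' x \<in> fm_ideal G'" and "f - f' \<in> fm_ideal G"
  shows "fm_bind \<theta> f - fm_bind \<theta>' f' \<in> fm_ideal G'"
proof -
  have "fm_bind \<theta> f - fm_bind \<theta>' f \<in> fm_ideal G'"
    unfolding fm_bind_def sum_subtractf[symmetric]
    by (intro fm_ideal_sum fm_ideal_cong_scale fm_ideal_cong_eval assms(2))
  moreover have "fm_bind \<theta>' (f - f') \<in> fm_ideal G'"
    by (rule fm_bind_ideal[OF assms(1) assms(3)])
  ultimately show ?thesis
    using fm_ideal_add[of "fm_bind \<theta> f - fm_bind \<theta>' f" G' "fm_bind \<theta>' (f - f')"]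
    by (simp add: fm_bind_diff)
qed

lemma commag_ideal_cong_bind:
  assumes "\<And>x. \<theta> x - \<theta>' x \<in> commag_ideal" and "f - f' \<in> commag_ideal"
  shows "fm_bind \<theta> f - fm_bind \<theta>' f' \<in> commag_ideal"
  using assms unfolding commag_ideal_def
  by (rule fm_ideal_cong_bind[rotated]) (auto simp: fm_bind_diff fm_bind_mult intro!: fm_ideal_gen, blast)

lemma nap_ideal_cong_bind:
  assumes "\<And>x. \<theta> x - \<theta>' x \<in> nap_ideal" and "f - f' \<in> nap_ideal"
  shows "fm_bind \<theta> f - fm_bind \<theta>' f' \<in> nap_ideal"
  using assms unfolding nap_ideal_def
  by (rule fm_ideal_cong_bind[rotated]) (auto simp: fm_bind_diff fm_bind_mult intro!: fm_ideal_gen, blast)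


section \<open>The operad \<open>ComMag\<close>\<close>

text \<open>
  The free \<open>ComMag\<close>-algebra on the generators \<open>'x\<close>. The component \<open>ComMag[S]\<close> is its subspace
  of multilinear elements in the generators \<open>S\<close>, an element of which is an operation with
  inputs \<open>S\<close>; the operad structure is substitution for generators. The free algebra
  on \<open>S\<close> embeds in the one on all of \<open>\<nat>\<close>, which serves as the ambient space.
\<close>

quotient_type (overloaded) ('x, 'k) free_commag = "'x mag \<Rightarrow>\<^sub>0 'k::field" / "\<lambda>f g. f - g \<in> commag_ideal"
  unfolding commag_ideal_def by (rule fm_ideal_equivp)

instantiation free_commag :: (type, field) ab_group_add
begin

lift_definition zero_free_commag :: "('a, 'b) free_commag" is 0 .

lift_definition plus_free_commag ::
  "('a, 'b) free_commag \<Rightarrow> ('a, 'b) free_commag \<Rightarrow> ('a, 'b) free_commag" is "(+)"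
  unfolding commag_ideal_def by (rule fm_ideal_cong_add)

lift_definition minus_free_commag ::
  "('a, 'b) free_commag \<Rightarrow> ('a, 'b) free_commag \<Rightarrow> ('a, 'b) free_commag" is "(-)"
  unfolding commag_ideal_def by (rule fm_ideal_cong_diff)

lift_definition uminus_free_commag :: "('a, 'b) free_commag \<Rightarrow> ('a, 'b) free_commag" is uminus
  unfolding commag_ideal_def by (rule fm_ideal_cong_uminus)

instance
  by standard (transfer, simp add: commag_ideal_def fm_ideal_zero algebra_simps)+

end

lift_definition commag_scale :: "'k::field \<Rightarrow> ('x, 'k) free_commag \<Rightarrow> ('x, 'k) free_commag"
  is fm_scale
  unfolding commag_ideal_def by (rule fm_ideal_cong_scale)

lift_definition commag_gen :: "'x \<Rightarrow> ('x, 'k::field) free_commag" is fm_gen .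

lift_definition commag_mult ::
  "('x, 'k::field) free_commag \<Rightarrow> ('x, 'k) free_commag \<Rightarrow> ('x, 'k) free_commag"
  (infixl \<open>\<odot>\<close> 70) is fm_mult
  unfolding commag_ideal_def by (rule fm_ideal_cong_mult)

lift_definition commag_bind ::
  "('x \<Rightarrow> ('y, 'k::field) free_commag) \<Rightarrow> ('x, 'k) free_commag \<Rightarrow> ('y, 'k) free_commag"
  is fm_bind
  by (rule commag_ideal_cong_bind)

definition commag_multilinear :: "'x set \<Rightarrow> ('x, 'k::field) free_commag set" where
  "commag_multilinear S = abs_free_commag ` fm_multilinear S"

lemma commag_commute: "x \<odot> y = y \<odot> x"
  by transfer (auto simp: commag_ideal_def intro!: fm_ideal_gen)

definition ComMag :: "('k::field, (nat, 'k) free_commag) operad_data" where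
  "ComMag = \<lparr>
     scal = commag_scale,
     comps = commag_multilinear,
     relabel = (\<lambda>S \<sigma>. commag_bind (\<lambda>s. commag_gen (\<sigma> s))),
     pcomp = (\<lambda>S s T x y. commag_bind (commag_gen(s := y)) x),
     unt = commag_gen\<rparr>"


section \<open>The operad \<open>NAP\<close>\<close>

text \<open>The free \<open>NAP\<close>-algebra on the generators \<open>'x\<close>, and its operad as for \<open>ComMag\<close>.\<close>

quotient_type (overloaded) ('x, 'k) free_nap = "'x mag \<Rightarrow>\<^sub>0 'k::field" / "\<lambda>f g. f - g \<in> nap_ideal"
  unfolding nap_ideal_def by (rule fm_ideal_equivp)

instantiation free_nap :: (type, field) ab_group_add
begin

lift_definition zero_free_nap :: "('a, 'b) free_nap" is 0 .

lift_definition plus_free_nap ::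
  "('a, 'b) free_nap \<Rightarrow> ('a, 'b) free_nap \<Rightarrow> ('a, 'b) free_nap" is "(+)"
  unfolding nap_ideal_def by (rule fm_ideal_cong_add)

lift_definition minus_free_nap ::
  "('a, 'b) free_nap \<Rightarrow> ('a, 'b) free_nap \<Rightarrow> ('a, 'b) free_nap" is "(-)"
  unfolding nap_ideal_def by (rule fm_ideal_cong_diff)

lift_definition uminus_free_nap :: "('a, 'b) free_nap \<Rightarrow> ('a, 'b) free_nap" is uminus
  unfolding nap_ideal_def by (rule fm_ideal_cong_uminus)

instance
  by standard (transfer, simp add: nap_ideal_def fm_ideal_zero algebra_simps)+

end

lift_definition nap_scale :: "'k::field \<Rightarrow> ('x, 'k) free_nap \<Rightarrow> ('x, 'k) free_nap"
  is fm_scale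
  unfolding nap_ideal_def by (rule fm_ideal_cong_scale)

lift_definition nap_gen :: "'x \<Rightarrow> ('x, 'k::field) free_nap" is fm_gen .

lift_definition nap_mult ::
  "('x, 'k::field) free_nap \<Rightarrow> ('x, 'k) free_nap \<Rightarrow> ('x, 'k) free_nap"
  (infixl \<open>\<star>\<close> 70) is fm_mult
  unfolding nap_ideal_def by (rule fm_ideal_cong_mult)

lift_definition nap_bind ::
  "('x \<Rightarrow> ('y, 'k::field) free_nap) \<Rightarrow> ('x, 'k) free_nap \<Rightarrow> ('y, 'k) free_nap"
  is fm_bind
  by (rule nap_ideal_cong_bind)

definition nap_multilinear :: "'x set \<Rightarrow> ('x, 'k::field) free_nap set" where
  "nap_multilinear S = abs_free_nap ` fm_multilinear S"

lemma nap_identity: "(x \<star> y) \<star> z = (x \<star> z) \<star> y"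
  by transfer (auto simp: nap_ideal_def intro!: fm_ideal_gen)

definition NAP :: "('k::field, (nat, 'k) free_nap) operad_data" where
  "NAP = \<lparr>
     scal = nap_scale,
     comps = nap_multilinear,
     relabel = (\<lambda>S \<sigma>. nap_bind (\<lambda>s. nap_gen (\<sigma> s))),
     pcomp = (\<lambda>S s T x y. nap_bind (nap_gen(s := y)) x),
     unt = nap_gen\<rparr>"

end

theory Submission
  imports Defs "HOL-Library.Multiset" "HOL-Library.Disjoint_Sets"
begin

text \<open>
  Commutative bracketings of a label set \<open>S\<close>, that is, binary trees without order on the two
  halves of each product, are a basis of \<open>ComMag[S]\<close>. Symmetrization sends such a bracketing to the
  sum of the rooted trees given by its planar representatives: each representative
  \<open>t = Prod a b\<close> yields the rooted tree of \<open>a\<close> with that of \<open>b\<close> grafted onto its root. The point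
  is that the matrix of this map is triangular, with ones on the diagonal, so that injectivity
  holds over every field.

  As planar representative of a commutative bracketing take the one whose every product has its
  greatest label on the right (\<open>norm_mag\<close>); its rooted tree is the leading term. Suppose that
  \<open>m = Prod b a\<close> is such a representative and some other monomial \<open>m' = Prod b' a'\<close> has the same
  rooted tree, with root \<open>r\<close>. Then \<open>a'\<close>, as a rooted tree, is one of the branches at \<open>r\<close>. If it is
  the branch \<open>a\<close>, then also \<open>b'\<close> and \<open>b\<close> have the same rooted tree, and recursion applies to both
  halves. If it is another branch, its labels lie in \<open>b\<close> but omit \<open>r\<close>, and in \<open>m'\<close> it
  is \<open>a'\<close> that lacks the greatest label; so the half without the greatest label is strictly smaller
  in \<open>m'\<close> than in \<open>m\<close>. The function \<open>weight\<close> orders bracketings lexicographically by the size of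
  this half, and \<open>tree_eq_imp_weight_less\<close> records that \<open>m'\<close> is lighter than \<open>m\<close> or equal to it.
  Consequently, for a combination of distinct commutative bracketings, the rooted tree of a
  representative of least weight has the coefficient of that bracketing in the image, and the
  combination is zero if its image is (\<open>fm_sym_eq_zero\<close>). Rooted trees are separated in the free
  \<open>NAP\<close>-algebra because grafting satisfies the \<open>NAP\<close> identity (\<open>tree_sum_nap_ideal\<close>).

  That the symmetrization is a morphism of operads at all comes from its compatibility with
  substitution (\<open>fm_sym_bind\<close>). It is the only morphism with the given value on the generator,
  since every monomial arises from generators by partial composition
  (\<open>morphism_eq_symmetrization\<close>).
\<close>


section \<open>Linear maps out of the free nonassociative algebra\<close>

definition fm_lin :: "('x mag \<Rightarrow> ('y mag \<Rightarrow>\<^sub>0 'k::field)) \<Rightarrow> ('x mag \<Rightarrow>\<^sub>0 'k) \<Rightarrow> ('y mag \<Rightarrow>\<^sub>0 'k)" where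
  "fm_lin h f = (\<Sum>t\<in>Poly_Mapping.keys f. fm_scale (Poly_Mapping.lookup f t) (h t))"

lemma fm_lin_superset:
  assumes "finite A" "Poly_Mapping.keys f \<subseteq> A"
  shows "fm_lin h f = (\<Sum>t\<in>A. fm_scale (Poly_Mapping.lookup f t) (h t))"
  unfolding fm_lin_def
  by (rule sum.mono_neutral_left) (use assms in \<open>auto simp: in_keys_iff\<close>)

lemma fm_lin_add: "fm_lin h (f + g) = fm_lin h f + fm_lin h g"
proof -
  let ?A = "Poly_Mapping.keys f \<union> Poly_Mapping.keys g"
  have "Poly_Mapping.keys (f + g) \<subseteq> ?A"
    by (rule keys_add)
  then show ?thesis
    by (simp add: fm_lin_superset[of ?A] lookup_add fm.scale_left_distrib sum.distrib)
qed

lemma fm_lin_scale: "fm_lin h (fm_scale c f) = fm_scale c (fm_lin h f)"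
proof -
  have "Poly_Mapping.keys (fm_scale c f) \<subseteq> Poly_Mapping.keys f"
    by (auto simp: in_keys_iff)
  then show ?thesis
    by (simp add: fm_lin_superset[of "Poly_Mapping.keys f"] fm.scale_sum_right)
qed

lemma fm_lin_zero [simp]: "fm_lin h 0 = 0"
  by (simp add: fm_lin_def)

lemma fm_lin_diff: "fm_lin h (f - g) = fm_lin h f - fm_lin h g"
  using fm_lin_add[of h "f - g" g] by simp

lemma fm_lin_single [simp]: "fm_lin h (Poly_Mapping.single t c) = fm_scale c (h t)"
  by (simp add: fm_lin_def)

lemma fm_mult_single:
  "fm_mult (Poly_Mapping.single s a) (Poly_Mapping.single t b) = Poly_Mapping.single (Prod s t) (a * b)"
  by (rule poly_mapping_eqI) (auto simp: lookup_fm_mult lookup_single when_def split: mag.splits)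

lemma single_Prod:
  "Poly_Mapping.single (Prod s t) 1 = fm_mult (Poly_Mapping.single s 1) (Poly_Mapping.single t 1)"
  by (simp add: fm_mult_single)

lemma fm_scale_single: "fm_scale c (Poly_Mapping.single t d) = Poly_Mapping.single t (c * d)"
  by (rule poly_mapping_eqI) (simp add: lookup_single when_def)

lemma fm_eval_cong:
  "(\<And>x. x \<in> set (leaves t) \<Longrightarrow> \<theta> x = \<theta>' x) \<Longrightarrow> fm_eval \<theta> t = fm_eval \<theta>' t"
  by (induction t) auto

lemma fm_eval_gen [simp]: "fm_eval fm_gen t = Poly_Mapping.single t 1"
  by (induction t) (simp_all add: fm_gen_def fm_mult_single)

lemma fm_bind_gen [simp]: "fm_bind fm_gen f = f"
  by (simp add: fm_bind_def fm_scale_single fm_expand[of f, symmetric])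

lemma fm_bind_apply_gen [simp]: "fm_bind \<theta> (fm_gen x) = \<theta> x"
  by (simp add: fm_gen_def)

lemma fm_bind_eval: "fm_bind \<eta> (fm_eval \<theta> t) = fm_eval (\<lambda>x. fm_bind \<eta> (\<theta> x)) t"
  by (induction t) (simp_all add: fm_bind_mult)

lemma fm_bind_bind: "fm_bind \<eta> (fm_bind \<theta> f) = fm_bind (\<lambda>x. fm_bind \<eta> (\<theta> x)) f"
  unfolding fm_bind_def[of \<theta>] fm_bind_def[of "\<lambda>x. fm_bind \<eta> (\<theta> x)"]
  by (simp add: fm_bind_sum fm_bind_scale fm_bind_eval)


section \<open>Multilinear elements\<close>

lemma leaves_nonempty [simp]: "leaves t \<noteq> []"
  by (induction t) simp_all

lemma fm_multilinearD:
  "f \<in> fm_multilinear S \<Longrightarrow> t \<in> Poly_Mapping.keys f \<Longrightarrow> distinct (leaves t) \<and> set (leaves t) = S"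
  by (auto simp: fm_multilinear_def)

lemma single_multilinear:
  "distinct (leaves t) \<Longrightarrow> set (leaves t) = S \<Longrightarrow> Poly_Mapping.single t c \<in> fm_multilinear S"
  by (auto simp: fm_multilinear_def)

lemma fm_gen_multilinear: "fm_gen x \<in> fm_multilinear {x}"
  by (simp add: fm_gen_def single_multilinear)

lemma zero_multilinear: "0 \<in> fm_multilinear S"
  by (simp add: fm_multilinear_def)

lemma add_multilinear:
  "f \<in> fm_multilinear S \<Longrightarrow> g \<in> fm_multilinear S \<Longrightarrow> f + g \<in> fm_multilinear S"
  unfolding fm_multilinear_def using keys_add[of f g] by blast

lemma scale_multilinear: "f \<in> fm_multilinear S \<Longrightarrow> fm_scale c f \<in> fm_multilinear S"
  by (auto simp: fm_multilinear_def in_keys_iff)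

lemma diff_multilinear:
  "f \<in> fm_multilinear S \<Longrightarrow> g \<in> fm_multilinear S \<Longrightarrow> f - g \<in> fm_multilinear S"
  using add_multilinear[OF _ scale_multilinear[of g S "-1"], of f] by simp

lemma fm_subspace_multilinear: "fm.subspace (fm_multilinear S)"
  by (rule fm.subspaceI) (simp_all add: zero_multilinear add_multilinear scale_multilinear)

lemma mult_multilinear:
  assumes "f \<in> fm_multilinear A" "g \<in> fm_multilinear B" "A \<inter> B = {}"
  shows "fm_mult f g \<in> fm_multilinear (A \<union> B)"
  unfolding fm_multilinear_def
proof clarify
  fix u assume "u \<in> Poly_Mapping.keys (fm_mult f g)"
  then obtain s t where "u = Prod s t" "s \<in> Poly_Mapping.keys f" "t \<in> Poly_Mapping.keys g"
    by (auto simp: in_keys_iff lookup_fm_mult split: mag.splits)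
  with assms fm_multilinearD[OF assms(1), of s] fm_multilinearD[OF assms(2), of t]
  show "distinct (leaves u) \<and> set (leaves u) = A \<union> B" by simp
qed

lemma fm_lin_multilinear:
  assumes "f \<in> fm_multilinear S"
    and "\<And>t. distinct (leaves t) \<Longrightarrow> set (leaves t) = S \<Longrightarrow> h t \<in> fm_multilinear S'"
  shows "fm_lin h f \<in> fm_multilinear S'"
  unfolding fm_lin_def
  by (intro fm.subspace_sum[OF fm_subspace_multilinear] scale_multilinear assms(2))
     (use assms(1) in \<open>auto dest: fm_multilinearD\<close>)

lemma fm_eval_multilinear:
  assumes "distinct (leaves t)" "\<And>s. s \<in> set (leaves t) \<Longrightarrow> \<theta> s \<in> fm_multilinear (T s)"
    and "disjoint_family_on T (set (leaves t))"
  shows "fm_eval \<theta> t \<in> fm_multilinear (\<Union>s\<in>set (leaves t). T s)"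
  using assms
proof (induction t)
  case (Prod a b)
  have "(\<Union>s\<in>set (leaves a). T s) \<inter> (\<Union>s\<in>set (leaves b). T s) = {}"
  proof -
    have "T s \<inter> T s' = {}" if "s \<in> set (leaves a)" "s' \<in> set (leaves b)" for s s'
    proof (rule disjoint_family_onD[OF Prod.prems(3)])
      show "s \<noteq> s'" using that Prod.prems(1) by auto
    qed (use that in simp_all)
    then show ?thesis by blast
  qed
  moreover have "disjoint_family_on T (set (leaves a))" "disjoint_family_on T (set (leaves b))"
    using Prod.prems(3) by (auto simp: disjoint_family_on_def)
  ultimately show ?case
    using mult_multilinear[OF Prod.IH] Prod.prems by (simp add: UN_Un)
qed auto

lemma fm_bind_multilinear:
  assumes "f \<in> fm_multilinear S" "\<And>s. s \<in> S \<Longrightarrow> \<theta> s \<in> fm_multilinear (T s)"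
    and "disjoint_family_on T S"
  shows "fm_bind \<theta> f \<in> fm_multilinear (\<Union>s\<in>S. T s)"
proof -
  have "fm_eval \<theta> t \<in> fm_multilinear (\<Union>s\<in>S. T s)"
    if "distinct (leaves t)" "set (leaves t) = S" for t
    using fm_eval_multilinear[of t \<theta> T] that assms(2,3) by simp
  from fm_lin_multilinear[OF assms(1) this] show ?thesis
    by (simp add: fm_lin_def fm_bind_def)
qed

lemma fm_bind_cong:
  assumes "f \<in> fm_multilinear S" "\<And>s. s \<in> S \<Longrightarrow> \<theta> s = \<theta>' s"
  shows "fm_bind \<theta> f = fm_bind \<theta>' f"
  unfolding fm_bind_def
  by (intro sum.cong refl arg_cong2[where f = fm_scale] fm_eval_cong)
     (use assms in \<open>auto dest: fm_multilinearD\<close>)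

lemma fm_eval_linear_at:
  assumes "distinct (leaves t)" "s \<in> set (leaves t)"
  shows "fm_eval (\<theta>(s := fm_scale c y + fm_scale d y')) t
    = fm_scale c (fm_eval (\<theta>(s := y)) t) + fm_scale d (fm_eval (\<theta>(s := y')) t)"
  using assms
proof (induction t)
  case (Prod a b)
  \<comment> \<open>exactly one of the two factors contains \<open>s\<close>, the value of the other is constant\<close>
  have const: "fm_eval (\<theta>(s := z)) u = fm_eval \<theta> u" if "s \<notin> set (leaves u)" for z u
    using that by (intro fm_eval_cong) auto
  consider "s \<in> set (leaves a)" "s \<notin> set (leaves b)" | "s \<in> set (leaves b)" "s \<notin> set (leaves a)"
    using Prod.prems by auto
  then show ?case
    using Prod const
    by cases (simp_all add: fm_mult_add_left fm_mult_add_right fm_mult_scale_left fm_mult_scale_right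
        del: fun_upd_apply)
qed auto

text \<open>
  Partial composition is linear in its second argument only because the plugged label occurs
  exactly once in each monomial.
\<close>

lemma fm_bind_linear_at:
  assumes "f \<in> fm_multilinear S" "s \<in> S"
  shows "fm_bind (\<theta>(s := fm_scale c y + fm_scale d y')) f
    = fm_scale c (fm_bind (\<theta>(s := y)) f) + fm_scale d (fm_bind (\<theta>(s := y')) f)"
proof -
  have "fm_eval (\<theta>(s := fm_scale c y + fm_scale d y')) t
      = fm_scale c (fm_eval (\<theta>(s := y)) t) + fm_scale d (fm_eval (\<theta>(s := y')) t)"
    if "t \<in> Poly_Mapping.keys f" for t
    using fm_multilinearD[OF assms(1) that] assms(2) by (intro fm_eval_linear_at) auto
  then show ?thesis
    by (simp add: fm_bind_def fm.scale_right_distrib sum.distrib fm.scale_sum_right mult.commute)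
qed

lemma relabel_multilinear:
  assumes "inj_on \<sigma> S" "f \<in> fm_multilinear S"
  shows "fm_bind (\<lambda>s. fm_gen (\<sigma> s)) f \<in> fm_multilinear (\<sigma> ` S)"
proof -
  have "disjoint_family_on (\<lambda>s. {\<sigma> s}) S"
    using assms(1) by (auto simp: disjoint_family_on_def inj_on_def)
  from fm_bind_multilinear[OF assms(2) fm_gen_multilinear this] show ?thesis
    by (simp add: UNION_singleton_eq_range)
qed

lemma pcomp_multilinear:
  assumes "pluggable S s T" "f \<in> fm_multilinear S" "g \<in> fm_multilinear T"
  shows "fm_bind (fm_gen(s := g)) f \<in> fm_multilinear ((S - {s}) \<union> T)"
proof -
  let ?T = "(\<lambda>u. {u})(s := T)"
  have "disjoint_family_on ?T S"
    using assms(1) by (auto simp: disjoint_family_on_def pluggable_def)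
  moreover have "(fm_gen(s := g)) u \<in> fm_multilinear (?T u)" if "u \<in> S" for u
    using assms(3) by (simp add: fm_gen_multilinear)
  ultimately have "fm_bind (fm_gen(s := g)) f \<in> fm_multilinear (\<Union>u\<in>S. ?T u)"
    using fm_bind_multilinear[OF assms(2)] by blast
  moreover have "(\<Union>u\<in>S. ?T u) = (S - {s}) \<union> T"
    using assms(1) by (auto simp: pluggable_def)
  ultimately show ?thesis by simp
qed


section \<open>Operads of multilinear elements in quotients of free algebras\<close>

text \<open>
  \<open>ComMag\<close> and \<open>NAP\<close> are both obtained from the free nonassociative algebra by a surjection \<open>q\<close>
  that is linear and compatible with substitution. These two properties alone give the operad
  axioms, which hold in the free nonassociative algebra and descend along \<open>q\<close>.
\<close>

locale substitution_quotient =
  fixes q :: "(nat mag \<Rightarrow>\<^sub>0 'k::field) \<Rightarrow> 'v::ab_group_add"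
    and scl :: "'k \<Rightarrow> 'v \<Rightarrow> 'v"
    and bnd :: "(nat \<Rightarrow> 'v) \<Rightarrow> 'v \<Rightarrow> 'v"
  assumes q_surj: "surj q"
    and q_add: "q (f + g) = q f + q g"
    and q_scale: "q (fm_scale c f) = scl c (q f)"
    and q_bind: "q (fm_bind \<theta> f) = bnd (\<lambda>x. q (\<theta> x)) (q f)"
begin

definition Op :: "('k, 'v) operad_data" where
  "Op = \<lparr>
     scal = scl,
     comps = (\<lambda>S. q ` fm_multilinear S),
     relabel = (\<lambda>S \<sigma>. bnd (\<lambda>s. q (fm_gen (\<sigma> s)))),
     pcomp = (\<lambda>S s T x y. bnd ((\<lambda>s. q (fm_gen s))(s := y)) x),
     unt = (\<lambda>s. q (fm_gen s))\<rparr>"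

lemma q_zero: "q 0 = 0"
  using q_add[of 0 0] by simp

lemma vector_space_scl: "vector_space scl"
proof
  fix a b :: 'k and x y :: 'v
  obtain f g where x: "x = q f" and y: "y = q g"
    using q_surj by (metis surjD)
  show "scl a (x + y) = scl a x + scl a y"
    by (simp add: x y q_add[symmetric] q_scale[symmetric] fm.scale_right_distrib)
  show "scl (a + b) x = scl a x + scl b x"
    by (simp add: x y q_add[symmetric] q_scale[symmetric] fm.scale_left_distrib)
  show "scl a (scl b x) = scl (a * b) x"
    by (simp add: x y q_scale[symmetric])
  show "scl 1 x = x"
    by (simp add: x y q_scale[symmetric])
qed

lemma relabel_Op: "relabel Op S \<sigma> (q f) = q (fm_bind (\<lambda>s. fm_gen (\<sigma> s)) f)"
  by (simp add: Op_def q_bind)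

lemma pcomp_Op: "pcomp Op S s T (q f) (q g) = q (fm_bind (fm_gen(s := g)) f)"
  by (simp add: Op_def q_bind fun_upd_def if_distrib cong: if_cong)

lemma operad_Op: "operad Op"
proof -
  interpret vector_space scl by (rule vector_space_scl)
  have scal: "scal Op = scl" and comps: "comps Op S = q ` fm_multilinear S"
    and unt: "unt Op s = q (fm_gen s)" for S s
    by (simp_all add: Op_def)
  show ?thesis
  proof (unfold_locales, unfold scal comps unt)
    fix S :: "nat set"
    show "subspace (q ` fm_multilinear S)"
      by (rule subspaceI)
         (auto simp: q_add[symmetric] q_scale[symmetric] q_zero[symmetric] zero_multilinear
            intro!: imageI add_multilinear scale_multilinear)
  next
    fix S x and \<sigma> :: "nat \<Rightarrow> nat"
    assume "inj_on \<sigma> S" "x \<in> q ` fm_multilinear S"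
    then show "relabel Op S \<sigma> x \<in> q ` fm_multilinear (\<sigma> ` S)"
      by (auto simp: relabel_Op intro!: imageI relabel_multilinear)
  next
    fix S x y and \<sigma> :: "nat \<Rightarrow> nat"
    assume "x \<in> q ` fm_multilinear S" "y \<in> q ` fm_multilinear S"
    then show "relabel Op S \<sigma> (x + y) = relabel Op S \<sigma> x + relabel Op S \<sigma> y"
      by (auto simp: q_add[symmetric] relabel_Op fm_bind_add)
  next
    fix S x c and \<sigma> :: "nat \<Rightarrow> nat"
    assume "x \<in> q ` fm_multilinear S"
    then show "relabel Op S \<sigma> (scl c x) = scl c (relabel Op S \<sigma> x)"
      by (auto simp: q_scale[symmetric] relabel_Op fm_bind_scale)
  next
    fix S x and \<sigma> \<tau> :: "nat \<Rightarrow> nat"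
    assume "\<And>s. s \<in> S \<Longrightarrow> \<sigma> s = \<tau> s" "x \<in> q ` fm_multilinear S"
    then show "relabel Op S \<sigma> x = relabel Op S \<tau> x"
      by (auto simp: relabel_Op intro!: arg_cong[where f = q] fm_bind_cong)
  next
    fix S x
    assume "x \<in> q ` fm_multilinear S"
    then show "relabel Op S id x = x"
      by (auto simp: relabel_Op)
  next
    fix S x and \<sigma> \<tau> :: "nat \<Rightarrow> nat"
    assume "x \<in> q ` fm_multilinear S"
    then show "relabel Op S (\<tau> \<circ> \<sigma>) x = relabel Op (\<sigma> ` S) \<tau> (relabel Op S \<sigma> x)"
      by (auto simp: relabel_Op fm_bind_bind)
  next
    fix S s T x y
    assume "pluggable S s T" "x \<in> q ` fm_multilinear S" "y \<in> q ` fm_multilinear T"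
    then show "pcomp Op S s T x y \<in> q ` fm_multilinear ((S - {s}) \<union> T)"
      by (auto simp del: fun_upd_apply simp: pcomp_Op intro!: imageI pcomp_multilinear)
  next
    fix S s T x x' y
    assume "x \<in> q ` fm_multilinear S" "x' \<in> q ` fm_multilinear S" "y \<in> q ` fm_multilinear T"
    then show "pcomp Op S s T (x + x') y = pcomp Op S s T x y + pcomp Op S s T x' y"
      by (auto simp: q_add[symmetric] pcomp_Op fm_bind_add)
  next
    fix S s T x y c
    assume "x \<in> q ` fm_multilinear S" "y \<in> q ` fm_multilinear T"
    then show "pcomp Op S s T (scl c x) y = scl c (pcomp Op S s T x y)"
      by (auto simp: q_scale[symmetric] pcomp_Op fm_bind_scale)
  next
    fix S s T x y y'
    assume "pluggable S s T"
      and "x \<in> q ` fm_multilinear S" "y \<in> q ` fm_multilinear T" "y' \<in> q ` fm_multilinear T"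
    then obtain f g g' where
      fg: "x = q f" "y = q g" "y' = q g'" "f \<in> fm_multilinear S" and "s \<in> S"
      by (auto simp: pluggable_def)
    from fm_bind_linear_at[OF this(4,5), of fm_gen 1 g 1 g']
    show "pcomp Op S s T x (y + y') = pcomp Op S s T x y + pcomp Op S s T x y'"
      by (simp add: fg q_add[symmetric] pcomp_Op)
  next
    fix S s T x y c
    assume "pluggable S s T" "x \<in> q ` fm_multilinear S" "y \<in> q ` fm_multilinear T"
    then obtain f g where fg: "x = q f" "y = q g" "f \<in> fm_multilinear S" and "s \<in> S"
      by (auto simp: pluggable_def)
    from fm_bind_linear_at[OF this(3,4), of fm_gen c g 0 0]
    show "pcomp Op S s T x (scl c y) = scl c (pcomp Op S s T x y)"
      by (simp add: fg q_scale[symmetric] pcomp_Op)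
  next
    fix S s T x y and \<sigma> \<tau> :: "nat \<Rightarrow> nat"
    assume plug: "pluggable S s T" and inj: "inj_on \<sigma> S"
      and "x \<in> q ` fm_multilinear S" "y \<in> q ` fm_multilinear T"
    then obtain f g where f: "x = q f" "f \<in> fm_multilinear S"
      and g: "y = q g" "g \<in> fm_multilinear T" by auto
    let ?\<rho> = "\<lambda>u. if u \<in> T then \<tau> u else \<sigma> u"
    have "fm_bind (\<lambda>s. fm_gen (?\<rho> s)) g = fm_bind (\<lambda>s. fm_gen (\<tau> s)) g"
      by (rule fm_bind_cong[OF g(2)]) simp
    moreover have "\<sigma> u \<noteq> \<sigma> s" "u \<notin> T" if "u \<in> S" "u \<noteq> s" for u
      using that plug inj by (auto simp: pluggable_def inj_on_def)
    ultimately have "fm_bind (\<lambda>s. fm_gen (?\<rho> s)) (fm_bind (fm_gen(s := g)) f)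
        = fm_bind (fm_gen(\<sigma> s := fm_bind (\<lambda>s. fm_gen (\<tau> s)) g)) (fm_bind (\<lambda>s. fm_gen (\<sigma> s)) f)"
      unfolding fm_bind_bind by (intro fm_bind_cong[OF f(2)]) auto
    then show "relabel Op ((S - {s}) \<union> T) ?\<rho> (pcomp Op S s T x y)
        = pcomp Op (\<sigma> ` S) (\<sigma> s) (\<tau> ` T) (relabel Op S \<sigma> x) (relabel Op T \<tau> y)"
      by (simp add: f(1) g(1) relabel_Op pcomp_Op)
  next
    fix S s T t U x y z
    assume plug: "pluggable S s T" "pluggable T t U"
      and "x \<in> q ` fm_multilinear S" "y \<in> q ` fm_multilinear T" "z \<in> q ` fm_multilinear U"
    then obtain f g h where f: "x = q f" "f \<in> fm_multilinear S"
      and gh: "y = q g" "z = q h" by auto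
    have "u \<noteq> t" if "u \<in> S" "u \<noteq> s" for u
      using that plug by (auto simp: pluggable_def)
    then have "fm_bind (fm_gen(t := h)) (fm_bind (fm_gen(s := g)) f)
        = fm_bind (fm_gen(s := fm_bind (fm_gen(t := h)) g)) f"
      unfolding fm_bind_bind by (intro fm_bind_cong[OF f(2)]) auto
    then show "pcomp Op ((S - {s}) \<union> T) t U (pcomp Op S s T x y) z
        = pcomp Op S s ((T - {t}) \<union> U) x (pcomp Op T t U y z)"
      by (simp add: f(1) gh pcomp_Op)
  next
    fix S s T s' U x y z
    assume plug: "pluggable S s T" "pluggable S s' U" "s \<noteq> s'"
      and "x \<in> q ` fm_multilinear S" "y \<in> q ` fm_multilinear T" "z \<in> q ` fm_multilinear U"
    then obtain f g h where f: "x = q f" "f \<in> fm_multilinear S"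
      and g: "y = q g" "g \<in> fm_multilinear T" and h: "z = q h" "h \<in> fm_multilinear U" by auto
    have "s' \<notin> T" "s \<notin> U"
      using plug by (auto simp: pluggable_def)
    then have "fm_bind (fm_gen(s' := h)) g = fm_bind fm_gen g"
      and "fm_bind (fm_gen(s := g)) h = fm_bind fm_gen h"
      by (intro fm_bind_cong[OF g(2)] fm_bind_cong[OF h(2)]; auto)+
    then have "fm_bind (fm_gen(s' := h)) (fm_bind (fm_gen(s := g)) f)
        = fm_bind (fm_gen(s := g)) (fm_bind (fm_gen(s' := h)) f)"
      unfolding fm_bind_bind using plug(3) by (intro fm_bind_cong[OF f(2)]) auto
    then show "pcomp Op ((S - {s}) \<union> T) s' U (pcomp Op S s T x y) z
        = pcomp Op ((S - {s'}) \<union> U) s T (pcomp Op S s' U x z) y"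
      by (simp add: f(1) g(1) h(1) pcomp_Op)
  next
    fix s
    show "q (fm_gen s) \<in> q ` fm_multilinear {s}"
      by (simp add: fm_gen_multilinear)
  next
    fix s and \<sigma> :: "nat \<Rightarrow> nat"
    show "relabel Op {s} \<sigma> (q (fm_gen s)) = q (fm_gen (\<sigma> s))"
      by (simp add: relabel_Op)
  next
    fix T s y
    assume "y \<in> q ` fm_multilinear T"
    then show "pcomp Op {s} s T (q (fm_gen s)) y = y"
      by (auto simp: pcomp_Op)
  next
    fix S s x
    assume "x \<in> q ` fm_multilinear S"
    then show "pcomp Op S s {s} x (q (fm_gen s)) = x"
      by (auto simp: pcomp_Op simp del: fun_upd_apply)
  qed (simp_all add: scale_right_distrib scale_left_distrib)
qed

end

interpretation commag: substitution_quotient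
  "abs_free_commag :: (nat mag \<Rightarrow>\<^sub>0 'k::field) \<Rightarrow> _" commag_scale commag_bind
proof
  show "surj (abs_free_commag :: (nat mag \<Rightarrow>\<^sub>0 'k) \<Rightarrow> _)"
    by (metis surjI Quotient_abs_rep Quotient_free_commag)
next
  fix \<theta> :: "nat \<Rightarrow> nat mag \<Rightarrow>\<^sub>0 'k" and f :: "nat mag \<Rightarrow>\<^sub>0 'k"
  have "g - rep_free_commag (abs_free_commag g) \<in> commag_ideal" for g :: "nat mag \<Rightarrow>\<^sub>0 'k"
    by (metis free_commag.abs_eq_iff Quotient_abs_rep Quotient_free_commag)
  then show "abs_free_commag (fm_bind \<theta> f) = commag_bind (\<lambda>x. abs_free_commag (\<theta> x)) (abs_free_commag f)"
    by (simp add: commag_bind_def map_fun_def comp_def free_commag.abs_eq_iff commag_ideal_cong_bind)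
qed (simp_all add: plus_free_commag.abs_eq commag_scale.abs_eq)

interpretation nap: substitution_quotient
  "abs_free_nap :: (nat mag \<Rightarrow>\<^sub>0 'k::field) \<Rightarrow> _" nap_scale nap_bind
proof
  show "surj (abs_free_nap :: (nat mag \<Rightarrow>\<^sub>0 'k) \<Rightarrow> _)"
    by (metis surjI Quotient_abs_rep Quotient_free_nap)
next
  fix \<theta> :: "nat \<Rightarrow> nat mag \<Rightarrow>\<^sub>0 'k" and f :: "nat mag \<Rightarrow>\<^sub>0 'k"
  have "g - rep_free_nap (abs_free_nap g) \<in> nap_ideal" for g :: "nat mag \<Rightarrow>\<^sub>0 'k"
    by (metis free_nap.abs_eq_iff Quotient_abs_rep Quotient_free_nap)
  then show "abs_free_nap (fm_bind \<theta> f) = nap_bind (\<lambda>x. abs_free_nap (\<theta> x)) (abs_free_nap f)"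
    by (simp add: nap_bind_def map_fun_def comp_def free_nap.abs_eq_iff nap_ideal_cong_bind)
qed (simp_all add: plus_free_nap.abs_eq nap_scale.abs_eq)

lemma ComMag_eq: "ComMag = commag.Op"
  by (simp add: ComMag_def commag.Op_def commag_multilinear_def[abs_def] commag_gen.abs_eq[abs_def])

lemma NAP_eq: "NAP = nap.Op"
  by (simp add: NAP_def nap.Op_def nap_multilinear_def[abs_def] nap_gen.abs_eq[abs_def])


section \<open>The symmetrization morphism\<close>

primrec sym_mon :: "'x mag \<Rightarrow> ('x mag \<Rightarrow>\<^sub>0 'k::field)" where
  "sym_mon (Gen x) = fm_gen x"
| "sym_mon (Prod s t) = fm_mult (sym_mon s) (sym_mon t) + fm_mult (sym_mon t) (sym_mon s)"

definition fm_sym :: "('x mag \<Rightarrow>\<^sub>0 'k::field) \<Rightarrow> ('x mag \<Rightarrow>\<^sub>0 'k)" where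
  "fm_sym = fm_lin sym_mon"

lemma fm_sym_add: "fm_sym (f + g) = fm_sym f + fm_sym g"
  and fm_sym_diff: "fm_sym (f - g) = fm_sym f - fm_sym g"
  and fm_sym_scale: "fm_sym (fm_scale c f) = fm_scale c (fm_sym f)"
  and fm_sym_zero [simp]: "fm_sym 0 = 0"
  and fm_sym_single [simp]: "fm_sym (Poly_Mapping.single t c) = fm_scale c (sym_mon t)"
  by (simp_all add: fm_sym_def fm_lin_add fm_lin_diff fm_lin_scale)

lemma fm_sym_sum: "fm_sym (sum h A) = (\<Sum>a\<in>A. fm_sym (h a))"
  by (induction A rule: infinite_finite_induct) (auto simp: fm_sym_add)

lemma fm_sym_gen [simp]: "fm_sym (fm_gen x) = fm_gen x"
  by (simp add: fm_gen_def)

lemma fm_sym_mult: "fm_sym (fm_mult f g) = fm_mult (fm_sym f) (fm_sym g) + fm_mult (fm_sym g) (fm_sym f)"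
proof -
  let ?F = "Poly_Mapping.keys f" and ?G = "Poly_Mapping.keys g"
  let ?c = "\<lambda>s t. Poly_Mapping.lookup f s * Poly_Mapping.lookup g t"
  have "fm_sym (fm_mult f g) =
      (\<Sum>s\<in>?F. \<Sum>t\<in>?G. fm_scale (?c s t) (fm_mult (sym_mon s) (sym_mon t)))
      + (\<Sum>s\<in>?F. \<Sum>t\<in>?G. fm_scale (?c s t) (fm_mult (sym_mon t) (sym_mon s)))"
    by (simp add: fm_mult_def[of f g] fm_sym_sum fm.scale_right_distrib sum.distrib)
  also have "(\<Sum>s\<in>?F. \<Sum>t\<in>?G. fm_scale (?c s t) (fm_mult (sym_mon s) (sym_mon t)))
      = fm_mult (fm_sym f) (fm_sym g)"
    unfolding fm_sym_def fm_lin_def fm_mult_sum_left fm_mult_sum_right fm_mult_scale_left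
      fm_mult_scale_right
    by (subst sum.swap) (simp add: fm.scale_sum_right mult.commute)
  also have "(\<Sum>s\<in>?F. \<Sum>t\<in>?G. fm_scale (?c s t) (fm_mult (sym_mon t) (sym_mon s)))
      = fm_mult (fm_sym g) (fm_sym f)"
    unfolding fm_sym_def fm_lin_def fm_mult_sum_left fm_mult_sum_right fm_mult_scale_left
      fm_mult_scale_right
    by (simp add: fm.scale_sum_right mult.commute)
  finally show ?thesis .
qed

lemma fm_sym_eval: "fm_sym (fm_eval \<theta> t) = fm_bind (\<lambda>x. fm_sym (\<theta> x)) (sym_mon t)"
  by (induction t) (simp_all add: fm_sym_mult fm_bind_add fm_bind_mult)

lemma fm_sym_bind: "fm_sym (fm_bind \<theta> f) = fm_bind (\<lambda>x. fm_sym (\<theta> x)) (fm_sym f)"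
  unfolding fm_bind_def[of \<theta> f] fm_sym_def[THEN fun_cong, of f] fm_lin_def
  by (simp add: fm_sym_sum fm_sym_scale fm_sym_eval fm_bind_sum fm_bind_scale)

text \<open>
  The symmetrized product is commutative on the nose, so that \<open>fm_sym\<close> kills the relations of
  \<open>ComMag\<close> before passing to \<open>NAP\<close>.
\<close>

lemma fm_sym_commag_ideal: "f \<in> commag_ideal \<Longrightarrow> fm_sym f = 0"
  unfolding commag_ideal_def
  by (induction rule: fm_ideal.induct)
     (auto simp: fm_sym_add fm_sym_diff fm_sym_scale fm_sym_mult add.commute)

lemma sym_mon_multilinear:
  "distinct (leaves t) \<Longrightarrow> sym_mon t \<in> fm_multilinear (set (leaves t))"
proof (induction t)
  case (Prod s t)
  then have IH: "sym_mon s \<in> (fm_multilinear (set (leaves s)) :: ('a mag \<Rightarrow>\<^sub>0 'b) set)"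
    "sym_mon t \<in> (fm_multilinear (set (leaves t)) :: ('a mag \<Rightarrow>\<^sub>0 'b) set)"
    and disj: "set (leaves s) \<inter> set (leaves t) = {}" "set (leaves t) \<inter> set (leaves s) = {}"
    by auto
  from mult_multilinear[OF IH disj(1)] mult_multilinear[OF IH(2,1) disj(2)] show ?case
    by (simp add: add_multilinear Un_commute)
qed (simp add: fm_gen_multilinear)

lemma fm_sym_multilinear: "f \<in> fm_multilinear S \<Longrightarrow> fm_sym f \<in> fm_multilinear S"
  unfolding fm_sym_def using sym_mon_multilinear by (blast intro: fm_lin_multilinear)

lift_definition symmetrization :: "('x, 'k::field) free_commag \<Rightarrow> ('x, 'k) free_nap" is fm_sym
proof -
  fix f g :: "'x mag \<Rightarrow>\<^sub>0 'k"
  assume "f - g \<in> commag_ideal"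
  then show "fm_sym f - fm_sym g \<in> nap_ideal"
    by (simp add: fm_sym_commag_ideal fm_sym_diff[symmetric] nap_ideal_def fm_ideal_zero)
qed

lemma symmetrization_generator:
  "symmetrization (commag_gen x \<odot> commag_gen y)
    = nap_gen x \<star> nap_gen y + nap_gen y \<star> nap_gen x"
  by transfer (simp add: fm_sym_mult nap_ideal_def fm_ideal_zero)

lemma operad_ComMag: "operad ComMag"
  unfolding ComMag_eq by (rule commag.operad_Op)

lemma operad_NAP: "operad NAP"
  unfolding NAP_eq by (rule nap.operad_Op)

lemma comps_ComMag: "comps ComMag S = abs_free_commag ` fm_multilinear S"
  by (simp add: ComMag_def commag_multilinear_def)

lemma comps_NAP: "comps NAP S = abs_free_nap ` fm_multilinear S"
  by (simp add: NAP_def nap_multilinear_def)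

lemma scal_simps: "scal ComMag = commag_scale" "scal NAP = nap_scale"
  by (simp_all add: ComMag_def NAP_def)

lemma unt_simps: "unt ComMag = commag_gen" "unt NAP = nap_gen"
  by (simp_all add: ComMag_def NAP_def)

lemma operad_morphism_symmetrization: "operad_morphism ComMag NAP (\<lambda>_. symmetrization)"
proof -
  interpret P: operad ComMag by (rule operad_ComMag)
  interpret Q: operad NAP by (rule operad_NAP)
  show ?thesis
  proof (unfold_locales, unfold comps_ComMag comps_NAP scal_simps unt_simps)
    fix S and x :: "(nat, 'a) free_commag"
    assume "x \<in> abs_free_commag ` fm_multilinear S"
    then show "symmetrization x \<in> abs_free_nap ` fm_multilinear S"
      by (auto simp: symmetrization.abs_eq fm_sym_multilinear)
  next
    fix x y :: "(nat, 'a) free_commag"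
    show "symmetrization (x + y) = symmetrization x + symmetrization y"
      by transfer (simp add: fm_sym_add nap_ideal_def fm_ideal_zero)
  next
    fix c and x :: "(nat, 'a) free_commag"
    show "symmetrization (commag_scale c x) = nap_scale c (symmetrization x)"
      by transfer (simp add: fm_sym_scale nap_ideal_def fm_ideal_zero)
  next
    fix S \<sigma> and x :: "(nat, 'a) free_commag"
    assume "x \<in> abs_free_commag ` fm_multilinear S"
    then show "symmetrization (relabel ComMag S \<sigma> x) = relabel NAP S \<sigma> (symmetrization x)"
      by (auto simp: ComMag_eq NAP_eq commag.relabel_Op nap.relabel_Op symmetrization.abs_eq
          fm_sym_bind)
  next
    fix S s T and x y :: "(nat, 'a) free_commag"
    assume "x \<in> abs_free_commag ` fm_multilinear S" "y \<in> abs_free_commag ` fm_multilinear T"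
    then obtain f g where x: "x = abs_free_commag f" and y: "y = abs_free_commag g" by auto
    have "(\<lambda>u. fm_sym ((fm_gen(s := g)) u)) = fm_gen(s := fm_sym g)" by auto
    then show "symmetrization (pcomp ComMag S s T x y)
        = pcomp NAP S s T (symmetrization x) (symmetrization y)"
      by (simp add: x y ComMag_eq NAP_eq commag.pcomp_Op nap.pcomp_Op symmetrization.abs_eq
          fm_sym_bind del: fun_upd_apply)
  next
    show "symmetrization (commag_gen s) = nap_gen s" for s
      by transfer (simp add: nap_ideal_def fm_ideal_zero)
  qed
qed

lemma commag_gen_comps: "commag_gen s \<in> comps ComMag {s}"
  by (auto simp: comps_ComMag commag_gen.abs_eq fm_gen_multilinear)

lemma commag_mult_comps:
  assumes "x \<in> comps ComMag A" "y \<in> comps ComMag B" "A \<inter> B = {}"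
  shows "x \<odot> y \<in> comps ComMag (A \<union> B)"
  using assms by (auto simp: comps_ComMag commag_mult.abs_eq mult_multilinear)

text \<open>
  The product of an operation with inputs \<open>A\<close> and one with inputs \<open>B\<close> is obtained by plugging
  both into the generating operation on two further labels.
\<close>

lemma pcomp_generator:
  fixes x y :: "(nat, 'k::field) free_commag"
  assumes "x \<in> comps ComMag A" "q \<notin> A" "p \<noteq> q"
  shows "pcomp ComMag (A \<union> {q}) q B (pcomp ComMag {p, q} p A (commag_gen p \<odot> commag_gen q) x) y
    = x \<odot> y"
proof -
  obtain f where x: "x = abs_free_commag f" and f: "f \<in> fm_multilinear A"
    using assms(1) by (auto simp: comps_ComMag)
  obtain g where y: "y = abs_free_commag g"
    using commag.q_surj by (metis surjD)
  have "fm_bind (fm_gen(q := g)) f = fm_bind fm_gen f"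
    by (rule fm_bind_cong[OF f]) (use assms(2) in auto)
  then show ?thesis
    using assms(3)
    by (simp add: x y ComMag_eq commag_gen.abs_eq commag_mult.abs_eq commag.pcomp_Op fm_bind_mult)
qed

text \<open>The generating operation generates: it determines a morphism out of \<open>ComMag\<close>.\<close>

lemma morphism_eq_symmetrization:
  fixes \<phi> :: "nat set \<Rightarrow> (nat, 'k::field) free_commag \<Rightarrow> (nat, 'k) free_nap"
  assumes mor: "operad_morphism ComMag NAP \<phi>"
    and gen: "\<phi> {1, 2} (commag_gen 1 \<odot> commag_gen 2)
      = nap_gen 1 \<star> nap_gen 2 + nap_gen 2 \<star> nap_gen 1"
    and S: "labels S" and x: "x \<in> comps ComMag S"
  shows "\<phi> S x = symmetrization x"
proof -
  interpret F: operad_morphism ComMag NAP \<phi> by (rule mor)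
  interpret G: operad_morphism ComMag NAP "\<lambda>_. symmetrization :: (nat, 'k) free_commag \<Rightarrow> _"
    by (rule operad_morphism_symmetrization)
  have gen': "\<phi> {p, q} (commag_gen p \<odot> commag_gen q) = symmetrization (commag_gen p \<odot> commag_gen q)"
    if "p \<noteq> q" for p q
  proof -
    \<comment> \<open>naturality carries the given value on the labels \<open>1, 2\<close> over to \<open>p, q\<close>\<close>
    define \<sigma> where "\<sigma> = (\<lambda>n::nat. if n = 1 then p else q)"
    have \<sigma>: "inj_on \<sigma> {1, 2}" "\<sigma> ` {1, 2} = {p, q}"
      using that by (auto simp: \<sigma>_def inj_on_def)
    have l: "labels {1, 2}" by (simp add: labels_def)
    let ?g = "commag_gen 1 \<odot> commag_gen 2 :: (nat, 'k) free_commag"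
    have g: "?g \<in> comps ComMag {1, 2}"
      using commag_mult_comps[OF commag_gen_comps commag_gen_comps, of 1 2] by (simp add: insert_commute)
    have "relabel ComMag {1, 2} \<sigma> ?g = commag_gen p \<odot> commag_gen q"
      by (simp add: ComMag_eq commag_gen.abs_eq commag_mult.abs_eq commag.relabel_Op fm_bind_mult \<sigma>_def)
    with F.relabel[OF l \<sigma>(1) g] G.relabel[OF l \<sigma>(1) g] show ?thesis
      by (simp only: \<sigma>(2) gen symmetrization_generator)
  qed
  have mon: "\<phi> (set (leaves t)) (abs_free_commag (Poly_Mapping.single t 1))
      = symmetrization (abs_free_commag (Poly_Mapping.single t 1))"
    if "distinct (leaves t)" for t
    using that
  proof (induction t)
    case (Gen s)
    have "commag_gen s = abs_free_commag (Poly_Mapping.single (Gen s) (1::'k))"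
      by (simp add: commag_gen.abs_eq fm_gen_def)
    then show ?case
      using F.unt[of s] G.unt[of s] by (simp add: unt_simps)
  next
    case (Prod a b)
    let ?m = "\<lambda>t. abs_free_commag (Poly_Mapping.single t (1::'k))"
    let ?A = "set (leaves a)" and ?B = "set (leaves b)"
    have lab: "labels ?A" "labels ?B"
      by (simp_all add: labels_def)
    have mem: "?m a \<in> comps ComMag ?A" "?m b \<in> comps ComMag ?B"
      using Prod.prems by (auto simp: comps_ComMag single_multilinear)
    obtain p where p: "p \<notin> ?A \<union> ?B"
      using ex_new_if_finite[of "?A \<union> ?B"] by auto
    obtain q where q: "q \<notin> insert p (?A \<union> ?B)"
      using ex_new_if_finite[of "insert p (?A \<union> ?B)"] by auto
    have plug1: "pluggable {p, q} p ?A" and plug2: "pluggable (?A \<union> {q}) q ?B"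
      using lab p q Prod.prems by (auto simp: pluggable_def labels_def)
    have sets: "({p, q} - {p}) \<union> ?A = ?A \<union> {q}" "((?A \<union> {q}) - {q}) \<union> ?B = set (leaves (Prod a b))"
      using p q by auto
    let ?g = "commag_gen p \<odot> commag_gen q :: (nat, 'k) free_commag"
    have g: "?g \<in> comps ComMag {p, q}"
      using commag_mult_comps[OF commag_gen_comps commag_gen_comps, of p q] q
      by (simp add: insert_commute)
    have ga: "pcomp ComMag {p, q} p ?A ?g (?m a) \<in> comps ComMag (?A \<union> {q})"
      using F.P.pcomp_closed[OF plug1 g mem(1)] by (simp only: sets)
    have "?m (Prod a b) = ?m a \<odot> ?m b"
      by (simp add: commag_mult.abs_eq fm_mult_single)
    also have "\<dots> = pcomp ComMag (?A \<union> {q}) q ?B (pcomp ComMag {p, q} p ?A ?g (?m a)) (?m b)"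
      using p q mem(1) by (intro pcomp_generator[symmetric]) auto
    finally have m: "?m (Prod a b) = \<dots>" .
    show ?case
      unfolding m
      using F.pcomp[OF plug2 ga mem(2)] G.pcomp[OF plug2 ga mem(2)]
        F.pcomp[OF plug1 g mem(1)] G.pcomp[OF plug1 g mem(1)] Prod q
      by (simp only: sets) (simp add: gen')
  qed
  obtain f where xf: "x = abs_free_commag f" and f: "f \<in> fm_multilinear S"
    using x by (auto simp: comps_ComMag)
  have lin: "\<phi> S (abs_free_commag (\<Sum>t\<in>M. Poly_Mapping.single t (Poly_Mapping.lookup f t)))
      = symmetrization (abs_free_commag (\<Sum>t\<in>M. Poly_Mapping.single t (Poly_Mapping.lookup f t)))"
    if "M \<subseteq> Poly_Mapping.keys f" "finite M" for M
    using that(2,1)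
  proof (induction M rule: finite_induct)
    case empty
    have "(0::(nat, 'k) free_commag) \<in> comps ComMag S"
      using F.P.subspace_0[OF F.P.comps_subspace[OF S]] .
    from F.add[OF S this this] G.add[OF S this this] show ?case
      by (simp add: commag.q_zero)
  next
    case (insert t M)
    let ?c = "Poly_Mapping.lookup f t"
    let ?s = "abs_free_commag (Poly_Mapping.single t 1)"
    let ?r = "abs_free_commag (\<Sum>t\<in>M. Poly_Mapping.single t (Poly_Mapping.lookup f t))"
    have t: "distinct (leaves t)" "set (leaves t) = S"
      using fm_multilinearD[OF f] insert.prems by auto
    have s: "?s \<in> comps ComMag S"
      using t by (simp add: comps_ComMag single_multilinear)
    have cs: "commag_scale ?c ?s \<in> comps ComMag S"
      using F.P.subspace_scale[OF F.P.comps_subspace[OF S] s] by (simp add: scal_simps)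
    have r: "?r \<in> comps ComMag S"
      unfolding comps_ComMag
      using insert.prems fm_multilinearD[OF f]
      by (intro imageI fm.subspace_sum[OF fm_subspace_multilinear] single_multilinear) auto
    have "abs_free_commag (\<Sum>t\<in>insert t M. Poly_Mapping.single t (Poly_Mapping.lookup f t))
        = commag_scale ?c ?s + ?r"
      using insert.hyps by (simp add: commag.q_add[symmetric] commag.q_scale[symmetric] fm_scale_single)
    then show ?case
      using F.add[OF S cs r] G.add[OF S cs r] F.scal[OF S s, of ?c] G.scal[OF S s, of ?c]
        mon[OF t(1)] insert t(2)
      by (simp add: scal_simps)
  qed
  from lin[OF order.refl finite_keys] show ?thesis
    by (simp add: xf fm_expand[of f, symmetric])
qed


section \<open>Rooted trees\<close>

datatype 'x rtree = Node 'x "'x rtree multiset"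

fun graft :: "'x rtree \<Rightarrow> 'x rtree \<Rightarrow> 'x rtree" where
  "graft (Node x ts) u = Node x (add_mset u ts)"

primrec tree :: "'x mag \<Rightarrow> 'x rtree" where
  "tree (Gen x) = Node x {#}"
| "tree (Prod s t) = graft (tree s) (tree t)"

lemma graft_commute: "graft (graft u v) w = graft (graft u w) v"
  by (cases u) (simp add: add_mset_commute)

lemma set_graft [simp]: "set_rtree (graft u v) = set_rtree u \<union> set_rtree v"
  by (cases u) auto

lemma set_tree [simp]: "set_rtree (tree t) = set (leaves t)"
  by (induction t) simp_all

text \<open>
  A functional on the span of rooted trees, pulled back along \<open>tree\<close>. Since grafting satisfies the
  \<open>NAP\<close> identity, it annihilates the ideal of \<open>NAP\<close> and can therefore detect that an element is
  nonzero in the free \<open>NAP\<close>-algebra.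
\<close>

definition tree_sum :: "('x rtree \<Rightarrow> 'k) \<Rightarrow> ('x mag \<Rightarrow>\<^sub>0 'k::field) \<Rightarrow> 'k" where
  "tree_sum \<phi> f = (\<Sum>t\<in>Poly_Mapping.keys f. Poly_Mapping.lookup f t * \<phi> (tree t))"

lemma tree_sum_superset:
  assumes "finite A" "Poly_Mapping.keys f \<subseteq> A"
  shows "tree_sum \<phi> f = (\<Sum>t\<in>A. Poly_Mapping.lookup f t * \<phi> (tree t))"
  unfolding tree_sum_def
  by (rule sum.mono_neutral_left) (use assms in \<open>auto simp: in_keys_iff\<close>)

lemma tree_sum_add: "tree_sum \<phi> (f + g) = tree_sum \<phi> f + tree_sum \<phi> g"
proof -
  let ?A = "Poly_Mapping.keys f \<union> Poly_Mapping.keys g"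
  have "Poly_Mapping.keys (f + g) \<subseteq> ?A"
    by (rule keys_add)
  then show ?thesis
    by (simp add: tree_sum_superset[of ?A] lookup_add distrib_right sum.distrib)
qed

lemma tree_sum_scale: "tree_sum \<phi> (fm_scale c f) = c * tree_sum \<phi> f"
proof -
  have "Poly_Mapping.keys (fm_scale c f) \<subseteq> Poly_Mapping.keys f"
    by (auto simp: in_keys_iff)
  then show ?thesis
    by (simp add: tree_sum_superset[of "Poly_Mapping.keys f"] sum_distrib_left mult.assoc)
qed

lemma tree_sum_zero [simp]: "tree_sum \<phi> 0 = 0"
  by (simp add: tree_sum_def)

lemma tree_sum_diff: "tree_sum \<phi> (f - g) = tree_sum \<phi> f - tree_sum \<phi> g"
  using tree_sum_add[of \<phi> "f - g" g] by simp

lemma tree_sum_sum: "tree_sum \<phi> (sum h A) = (\<Sum>a\<in>A. tree_sum \<phi> (h a))"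
  by (induction A rule: infinite_finite_induct) (auto simp: tree_sum_add)

lemma tree_sum_single [simp]: "tree_sum \<phi> (Poly_Mapping.single t c) = c * \<phi> (tree t)"
  by (simp add: tree_sum_def)

text \<open>
  In this nested form the roles of the two factors separate: if one of them is annihilated by all
  functionals, so is the product.
\<close>

lemma tree_sum_mult: "tree_sum \<phi> (fm_mult f g) = tree_sum (\<lambda>u. tree_sum (\<lambda>v. \<phi> (graft u v)) g) f"
  unfolding fm_mult_def tree_sum_sum
  by (simp add: tree_sum_def[of _ f] tree_sum_def[of _ g] sum_distrib_left mult.assoc)

lemma tree_sum_swap:
  "tree_sum (\<lambda>u. tree_sum (\<lambda>v. \<psi> u v) g) f = tree_sum (\<lambda>v. tree_sum (\<lambda>u. \<psi> u v) f) g"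
  unfolding tree_sum_def sum_distrib_left by (subst sum.swap) (simp add: ac_simps)

lemma tree_sum_nap_ideal: "f \<in> nap_ideal \<Longrightarrow> tree_sum \<phi> f = 0"
  unfolding nap_ideal_def
proof (induction arbitrary: \<phi> rule: fm_ideal.induct)
  case (fm_ideal_gen g)
  then obtain x y z where "g = fm_mult (fm_mult x y) z - fm_mult (fm_mult x z) y" by blast
  moreover have "tree_sum \<phi> (fm_mult (fm_mult x y) z) = tree_sum \<phi> (fm_mult (fm_mult x z) y)"
    unfolding tree_sum_mult
    by (subst (2) tree_sum_swap) (simp only: graft_commute)
  ultimately show ?case
    by (simp add: tree_sum_diff)
next
  case (fm_ideal_mult_left f h)
  then have "(\<lambda>u. tree_sum (\<lambda>v. \<phi> (graft u v)) f) = (\<lambda>_. 0)" by blast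
  then show ?case
    by (simp add: tree_sum_mult) (simp add: tree_sum_def)
qed (simp_all add: tree_sum_add tree_sum_scale tree_sum_mult)


section \<open>Normal forms of commutative monomials\<close>

definition last_max :: "'x::linorder mag \<Rightarrow> 'x mag \<Rightarrow> bool" where
  "last_max s t \<longleftrightarrow> Max (set (leaves s) \<union> set (leaves t)) \<in> set (leaves t)"

primrec norm_mag :: "'x::linorder mag \<Rightarrow> 'x mag" where
  "norm_mag (Gen x) = Gen x"
| "norm_mag (Prod s t) =
    (if last_max s t then Prod (norm_mag s) (norm_mag t) else Prod (norm_mag t) (norm_mag s))"

text \<open>
  The lexicographic order by the size of the half without the greatest label, then by the weights
  of both halves, packed into one number: the factorial exceeds any sum of weights of two halves
  with the given total number of leaves (\<open>weight_subtrees_less\<close>).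
\<close>

primrec weight :: "'x::linorder mag \<Rightarrow> nat" where
  "weight (Gen x) = 0"
| "weight (Prod s t) =
    fact (length (leaves s) + length (leaves t))
      * (if last_max s t then length (leaves s) else length (leaves t)) + weight s + weight t"

lemma last_max_commute:
  fixes s t :: "'x::linorder mag"
  assumes "set (leaves s) \<inter> set (leaves t) = {}"
  shows "last_max t s \<longleftrightarrow> \<not> last_max s t"
proof -
  have "Max (set (leaves s) \<union> set (leaves t)) \<in> set (leaves s) \<union> set (leaves t)"
    by (rule Max_in) simp_all
  then show ?thesis
    using assms by (auto simp: last_max_def Un_commute)
qed

lemma mset_leaves_norm_mag [simp]: "mset (leaves (norm_mag t)) = mset (leaves t)"
  by (induction t) simp_all

lemma set_leaves_norm_mag [simp]: "set (leaves (norm_mag t)) = set (leaves t)"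
  by (metis mset_leaves_norm_mag set_mset_mset)

lemma distinct_leaves_norm_mag [simp]: "distinct (leaves (norm_mag t)) = distinct (leaves t)"
  by (rule mset_eq_imp_distinct_iff) simp

lemma last_max_norm_mag [simp]: "last_max (norm_mag s) (norm_mag t) = last_max s t"
  by (simp add: last_max_def)

lemma norm_mag_idem [simp]: "distinct (leaves t) \<Longrightarrow> norm_mag (norm_mag t) = norm_mag t"
  by (induction t) (auto simp: last_max_commute)

text \<open>Both \<open>a!\<close> and \<open>b!\<close> are at most \<open>(a + b - 1)!\<close>.\<close>

lemma mult_fact_add_le:
  fixes a b :: nat
  assumes "0 < a" "0 < b"
  shows "a * fact a + b * fact b \<le> (fact (a + b) :: nat)"
proof -
  obtain N where N: "a + b = Suc N"
    using assms by (metis add_gr_0 gr0_implies_Suc)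
  have "a * fact a + b * fact b \<le> a * fact N + b * (fact N :: nat)"
    using assms N by (intro add_mono mult_left_mono fact_mono) auto
  also have "\<dots> = fact (a + b)"
    by (simp add: N add_mult_distrib[symmetric])
  finally show ?thesis .
qed

lemma weight_less: "weight t < length (leaves t) * fact (length (leaves t))"
proof (induction t)
  case (Prod s t)
  let ?a = "length (leaves s)" and ?b = "length (leaves t)"
  let ?m = "if last_max s t then ?a else ?b"
  have pos: "0 < ?a" "0 < ?b" by simp_all
  have "Suc ?m * fact (?a + ?b) \<le> (?a + ?b) * fact (?a + ?b)"
    using pos by (intro mult_right_mono) (auto simp: Suc_le_eq simp del: length_greater_0_conv)
  moreover have "weight s + weight t < fact (?a + ?b)"
    using Prod.IH mult_fact_add_le[OF pos] by linarith
  ultimately show ?case by (simp add: algebra_simps)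
qed simp

lemma weight_subtrees_less: "weight s + weight t < fact (length (leaves s) + length (leaves t))"
  using weight_less[of s] weight_less[of t] mult_fact_add_le[of "length (leaves s)" "length (leaves t)"]
  by simp

text \<open>
  A normal monomial is the heaviest among the monomials with its rooted tree. The last factor of
  any such monomial is a branch of that tree at the root. When it is not the branch \<open>a\<close>, its leaves
  form a proper part of those of \<open>b\<close>, because the root belongs to \<open>b\<close>.
\<close>

lemma tree_eq_imp_weight_less:
  fixes m m' :: "'x::linorder mag"
  assumes "norm_mag m = m" "distinct (leaves m)" "distinct (leaves m')" "tree m' = tree m"
  shows "m' = m \<or> weight m' < weight m"
  using assms
proof (induction m arbitrary: m')
  case (Gen x)
  show ?case
  proof (cases m')
    case (Prod c d)
    with Gen.prems show ?thesis by (cases "tree c") simp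
  qed (use Gen.prems in simp)
next
  case (Prod b a)
  have max: "last_max b a" and nb: "norm_mag b = b" and na: "norm_mag a = a"
    using Prod.prems(1,2) by (auto simp: last_max_def split: if_splits)
  obtain b' a' where m': "m' = Prod b' a'"
    using Prod.prems(4) by (cases m'; cases "tree b") auto
  obtain r ts where b: "tree b = Node r ts" by (cases "tree b")
  obtain r' ts' where b': "tree b' = Node r' ts'" by (cases "tree b'")
  have eq: "r' = r" "add_mset (tree a') ts' = add_mset (tree a) ts"
    using Prod.prems(4) by (simp_all add: m' b b')
  have sets: "set (leaves b') \<union> set (leaves a') = set (leaves b) \<union> set (leaves a)"
    using arg_cong[OF Prod.prems(4), of set_rtree] by (simp add: m')
  have len: "length (leaves b') + length (leaves a') = length (leaves b) + length (leaves a)"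
    using arg_cong[OF sets, of card] Prod.prems(2,3)
    by (simp add: m' card_Un_disjoint distinct_card)
  show ?case
  proof (cases "tree a' = tree a")
    case True
    with eq have "tree b' = tree b" by (simp add: b b')
    with True Prod have IH: "b' = b \<or> weight b' < weight b" "a' = a \<or> weight a' < weight a"
      using nb na by (simp_all add: m')
    have "set (leaves a') = set (leaves a)" "set (leaves b') = set (leaves b)"
      using True \<open>tree b' = tree b\<close> by (metis set_tree)+
    then have "length (leaves b') = length (leaves b)" "last_max b' a'"
      using Prod.prems(2,3) max by (auto simp: m' last_max_def distinct_card[symmetric])
    then show ?thesis
      using IH max len by (auto simp: m')
  next
    case False
    then have "tree a' \<in># ts"
      using insert_noteq_member[OF eq(2)[symmetric]] by simp
    then have "set_rtree (tree a') \<subseteq> set_rtree (tree b)"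
      unfolding b by auto
    moreover have "r \<in> set_rtree (tree b)" "r \<in> set_rtree (tree b')"
      by (simp_all add: b b' eq(1))
    ultimately have "set (leaves a') \<subset> set (leaves b)"
      using Prod.prems(3) by (auto simp: m')
    then have less: "length (leaves a') < length (leaves b)"
      using Prod.prems(2,3) psubset_card_mono[of "set (leaves b)" "set (leaves a')"]
      by (simp add: m' distinct_card)
    \<comment> \<open>the greatest label is in \<open>a\<close>, hence not in \<open>a'\<close>, and \<open>a'\<close> is the half that counts for the weight\<close>
    have "\<not> last_max b' a'"
      using max Prod.prems(2) \<open>set (leaves a') \<subset> set (leaves b)\<close> by (auto simp: last_max_def sets)
    then have "weight m' < fact (length (leaves b) + length (leaves a)) * Suc (length (leaves a'))"
      using weight_subtrees_less[of b' a'] by (simp add: m' len)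
    also have "\<dots> \<le> fact (length (leaves b) + length (leaves a)) * length (leaves b)"
      using less by (intro mult_left_mono) auto
    also have "\<dots> \<le> weight (Prod b a)"
      using max by simp
    finally show ?thesis by simp
  qed
qed


section \<open>Injectivity\<close>

lemma single_diff_norm_mag:
  "Poly_Mapping.single t 1 - Poly_Mapping.single (norm_mag t) 1
    \<in> (commag_ideal :: ('x::linorder mag \<Rightarrow>\<^sub>0 'k::field) set)"
proof (induction t)
  case (Prod s t)
  let ?m = "\<lambda>t. Poly_Mapping.single t 1 :: 'x mag \<Rightarrow>\<^sub>0 'k"
  have cong: "fm_mult (?m s) (?m t) - fm_mult (?m (norm_mag s)) (?m (norm_mag t)) \<in> commag_ideal"
    using Prod.IH unfolding commag_ideal_def by (rule fm_ideal_cong_mult)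
  have "fm_mult (?m (norm_mag s)) (?m (norm_mag t)) - fm_mult (?m (norm_mag t)) (?m (norm_mag s))
      \<in> commag_ideal"
    unfolding commag_ideal_def by (rule fm_ideal_gen) blast
  with cong have
    "fm_mult (?m s) (?m t) - fm_mult (?m (norm_mag t)) (?m (norm_mag s)) \<in> commag_ideal"
    unfolding commag_ideal_def by (rule transpE[OF equivp_imp_transp[OF fm_ideal_equivp]])
  with cong show ?case
    by (simp add: single_Prod)
qed (simp add: commag_ideal_def fm_ideal_zero)

definition fm_norm :: "('x::linorder mag \<Rightarrow>\<^sub>0 'k::field) \<Rightarrow> ('x mag \<Rightarrow>\<^sub>0 'k)" where
  "fm_norm = fm_lin (\<lambda>t. Poly_Mapping.single (norm_mag t) 1)"

lemma diff_fm_norm: "f - fm_norm f \<in> commag_ideal"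
proof -
  have "f - fm_norm f = (\<Sum>t\<in>Poly_Mapping.keys f. fm_scale (Poly_Mapping.lookup f t)
      (Poly_Mapping.single t 1 - Poly_Mapping.single (norm_mag t) 1))"
    by (subst fm_expand[of f])
       (simp add: fm_norm_def fm_lin_def fm_scale_single fm.scale_right_diff_distrib sum_subtractf)
  then show ?thesis
    using single_diff_norm_mag unfolding commag_ideal_def
    by (auto intro!: fm_ideal_sum fm_ideal_scale)
qed

lemma fm_norm_multilinear: "f \<in> fm_multilinear S \<Longrightarrow> fm_norm f \<in> fm_multilinear S"
  unfolding fm_norm_def by (erule fm_lin_multilinear) (simp add: single_multilinear)

lemma fm_norm_keys:
  assumes "f \<in> fm_multilinear S" "t \<in> Poly_Mapping.keys (fm_norm f)"
  shows "norm_mag t = t"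
proof -
  have "Poly_Mapping.lookup (fm_norm f) t \<noteq> 0"
    using assms(2) by (simp add: in_keys_iff)
  then obtain s where "s \<in> Poly_Mapping.keys f" "t = norm_mag s"
    by (auto simp: fm_norm_def fm_lin_def lookup_sum lookup_single when_def
        elim!: sum.not_neutral_contains_not_neutral split: if_splits)
  with fm_multilinearD[OF assms(1)] show ?thesis by simp
qed

text \<open>
  The monomials of \<open>sym_mon t\<close> differ from \<open>t\<close> only by swapping halves of products, which changes
  neither the normal form nor the weight.
\<close>

lemma sym_mon_keys:
  assumes "distinct (leaves t)" "u \<in> Poly_Mapping.keys (sym_mon t :: 'x::linorder mag \<Rightarrow>\<^sub>0 'k::field)"
  shows "norm_mag u = norm_mag t \<and> weight u = weight t \<and> distinct (leaves u)
    \<and> set (leaves u) = set (leaves t)"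
  using assms
proof (induction t arbitrary: u)
  case (Gen x)
  then show ?case by (simp add: fm_gen_def)
next
  case (Prod s t)
  have dist: "distinct (leaves s)" "distinct (leaves t)" "set (leaves s) \<inter> set (leaves t) = {}"
    using Prod.prems(1) by auto
  from Prod.prems(2) have "u \<in> Poly_Mapping.keys (fm_mult (sym_mon s) (sym_mon t) :: 'x mag \<Rightarrow>\<^sub>0 'k)
      \<or> u \<in> Poly_Mapping.keys (fm_mult (sym_mon t) (sym_mon s) :: 'x mag \<Rightarrow>\<^sub>0 'k)"
    using keys_add by fastforce
  then obtain a b where u: "u = Prod a b"
    and ab: "a \<in> Poly_Mapping.keys (sym_mon s :: 'x mag \<Rightarrow>\<^sub>0 'k)
        \<and> b \<in> Poly_Mapping.keys (sym_mon t :: 'x mag \<Rightarrow>\<^sub>0 'k)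
      \<or> a \<in> Poly_Mapping.keys (sym_mon t :: 'x mag \<Rightarrow>\<^sub>0 'k)
        \<and> b \<in> Poly_Mapping.keys (sym_mon s :: 'x mag \<Rightarrow>\<^sub>0 'k)"
    by (cases u) (auto simp: in_keys_iff lookup_fm_mult)
  from ab show ?case
  proof (elim disjE conjE)
    assume "a \<in> Poly_Mapping.keys (sym_mon s :: 'x mag \<Rightarrow>\<^sub>0 'k)"
      "b \<in> Poly_Mapping.keys (sym_mon t :: 'x mag \<Rightarrow>\<^sub>0 'k)"
    with Prod.IH dist have a: "norm_mag a = norm_mag s" "weight a = weight s" "distinct (leaves a)"
        "set (leaves a) = set (leaves s)"
      and b: "norm_mag b = norm_mag t" "weight b = weight t" "distinct (leaves b)"
        "set (leaves b) = set (leaves t)"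
      by blast+
    then have "length (leaves a) = length (leaves s)" "length (leaves b) = length (leaves t)"
      using dist by (metis distinct_card)+
    then show ?thesis
      using a b dist(3) by (simp add: u last_max_def)
  next
    assume "a \<in> Poly_Mapping.keys (sym_mon t :: 'x mag \<Rightarrow>\<^sub>0 'k)"
      "b \<in> Poly_Mapping.keys (sym_mon s :: 'x mag \<Rightarrow>\<^sub>0 'k)"
    with Prod.IH dist have a: "norm_mag a = norm_mag t" "weight a = weight t" "distinct (leaves a)"
        "set (leaves a) = set (leaves t)"
      and b: "norm_mag b = norm_mag s" "weight b = weight s" "distinct (leaves b)"
        "set (leaves b) = set (leaves s)"
      by blast+
    then have "length (leaves a) = length (leaves t)" "length (leaves b) = length (leaves s)"
      using dist by (metis distinct_card)+
    moreover have "last_max a b \<longleftrightarrow> \<not> last_max s t"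
      using last_max_commute[OF dist(3)] a b by (simp add: last_max_def)
    ultimately show ?thesis
      using a b dist(3) by (auto simp: u add.commute)
  qed
qed

text \<open>
  The diagonal entry is one in every characteristic: the labels being distinct, the second summand
  of a symmetrized product cannot contribute.
\<close>

lemma lookup_sym_mon_self:
  "distinct (leaves t) \<Longrightarrow> Poly_Mapping.lookup (sym_mon t :: 'x::linorder mag \<Rightarrow>\<^sub>0 'k::field) t = 1"
proof (induction t)
  case (Gen x)
  then show ?case by (simp add: fm_gen_def)
next
  case (Prod s t)
  have "s \<notin> Poly_Mapping.keys (sym_mon t :: 'x mag \<Rightarrow>\<^sub>0 'k)"
  proof
    assume "s \<in> Poly_Mapping.keys (sym_mon t :: 'x mag \<Rightarrow>\<^sub>0 'k)"
    then have "set (leaves s) = set (leaves t)"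
      using sym_mon_keys[of t s] Prod.prems by auto
    then have "set (leaves s) = {}"
      using Prod.prems by auto
    then show False by simp
  qed
  with Prod show ?case
    by (simp add: lookup_add lookup_fm_mult in_keys_iff)
qed

text \<open>
  Triangularity: for a monomial \<open>m\<close> of least weight in \<open>f\<close>, no other monomial of \<open>f\<close> contributes to
  the coefficient of \<open>tree m\<close> in \<open>fm_sym f\<close>, which is therefore the coefficient of \<open>m\<close> in \<open>f\<close>.
\<close>

lemma fm_sym_eq_zero:
  fixes f :: "'x::linorder mag \<Rightarrow>\<^sub>0 'k::field"
  assumes f: "f \<in> fm_multilinear S" and norm: "\<And>t. t \<in> Poly_Mapping.keys f \<Longrightarrow> norm_mag t = t"
    and ideal: "fm_sym f \<in> nap_ideal"
  shows "f = 0"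
proof (rule ccontr)
  assume "f \<noteq> 0"
  then have "Poly_Mapping.keys f \<noteq> {}" by simp
  then obtain m where m: "m \<in> Poly_Mapping.keys f"
    and min: "\<And>t. t \<in> Poly_Mapping.keys f \<Longrightarrow> weight m \<le> weight t"
    using ex_min_if_finite[of "weight ` Poly_Mapping.keys f"] by (auto simp: not_less)
  let ?\<phi> = "\<lambda>u. if u = tree m then 1 else 0 :: 'k"
  have dist: "distinct (leaves t)" if "t \<in> Poly_Mapping.keys f" for t
    using fm_multilinearD[OF f that] by simp
  have only_m: "u = m \<and> t = m"
    if t: "t \<in> Poly_Mapping.keys f" and u: "u \<in> Poly_Mapping.keys (sym_mon t :: 'x mag \<Rightarrow>\<^sub>0 'k)"
      and "tree u = tree m" for t u
  proof -
    note key = sym_mon_keys[OF dist[OF t] u]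
    then have "\<not> weight u < weight m"
      using min[OF t] by simp
    with tree_eq_imp_weight_less[OF norm[OF m] dist[OF m] _ that(3)] key have "u = m" by blast
    with key norm[OF m] norm[OF t] show ?thesis by simp
  qed
  have "tree_sum ?\<phi> (sym_mon t) = (if t = m then 1 else 0)" if t: "t \<in> Poly_Mapping.keys f" for t
  proof -
    have "tree_sum ?\<phi> (sym_mon t) = (\<Sum>u\<in>Poly_Mapping.keys (sym_mon t :: 'x mag \<Rightarrow>\<^sub>0 'k).
        if u = m then (if t = m then Poly_Mapping.lookup (sym_mon t) u else 0) else 0)"
      unfolding tree_sum_def by (intro sum.cong refl) (use only_m[OF t] in auto)
    also have "\<dots> = (if t = m then Poly_Mapping.lookup (sym_mon m) m else 0)"
      by (simp add: in_keys_iff)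
    finally show ?thesis
      by (simp add: lookup_sym_mon_self[OF dist[OF m]])
  qed
  then have "tree_sum ?\<phi> (fm_sym f)
      = (\<Sum>t\<in>Poly_Mapping.keys f. if t = m then Poly_Mapping.lookup f t else 0)"
    unfolding fm_sym_def fm_lin_def tree_sum_sum tree_sum_scale by (intro sum.cong refl) simp
  also have "\<dots> = Poly_Mapping.lookup f m"
    using m by simp
  finally show False
    using m tree_sum_nap_ideal[OF ideal, of ?\<phi>] by (simp add: in_keys_iff)
qed

lemma fm_sym_nap_ideal_imp_commag_ideal:
  fixes f :: "'x::linorder mag \<Rightarrow>\<^sub>0 'k::field"
  assumes "f \<in> fm_multilinear S" "fm_sym f \<in> nap_ideal"
  shows "f \<in> commag_ideal"
proof -
  have "fm_sym (fm_norm f) = fm_sym f"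
    using fm_sym_commag_ideal[OF diff_fm_norm[of f]] by (simp add: fm_sym_diff)
  then have "fm_norm f = 0"
    using fm_sym_eq_zero[OF fm_norm_multilinear[OF assms(1)] fm_norm_keys[OF assms(1)]] assms(2)
    by simp
  with diff_fm_norm[of f] show ?thesis by simp
qed

lemma inj_on_symmetrization:
  "inj_on (symmetrization :: (nat, 'k::field) free_commag \<Rightarrow> _) (comps ComMag S)"
proof (rule inj_onI)
  fix x y :: "(nat, 'k) free_commag"
  assume "x \<in> comps ComMag S" "y \<in> comps ComMag S" and eq: "symmetrization x = symmetrization y"
  then obtain f g where f: "x = abs_free_commag f" "f \<in> fm_multilinear S"
    and g: "y = abs_free_commag g" "g \<in> fm_multilinear S"
    by (auto simp: comps_ComMag)
  have "fm_sym (f - g) \<in> nap_ideal"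
    using eq by (simp add: f g symmetrization.abs_eq free_nap.abs_eq_iff fm_sym_diff)
  then have "f - g \<in> commag_ideal"
    by (rule fm_sym_nap_ideal_imp_commag_ideal[OF diff_multilinear[OF f(2) g(2)]])
  then show "x = y"
    by (simp add: f g free_commag.abs_eq_iff)
qed

theorem theorem4p2:
  shows "(\<exists>\<phi> :: nat set \<Rightarrow> (nat, 'k::field) free_commag \<Rightarrow> (nat, 'k) free_nap.
            operad_morphism ComMag NAP \<phi> \<and>
            \<phi> {1, 2} (commag_gen 1 \<odot> commag_gen 2)
              = nap_gen 1 \<star> nap_gen 2 + nap_gen 2 \<star> nap_gen 1) \<and>
         (\<forall>\<phi> :: nat set \<Rightarrow> (nat, 'k) free_commag \<Rightarrow> (nat, 'k) free_nap.
            operad_morphism ComMag NAP \<phi> \<longrightarrow>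
            \<phi> {1, 2} (commag_gen 1 \<odot> commag_gen 2)
              = nap_gen 1 \<star> nap_gen 2 + nap_gen 2 \<star> nap_gen 1 \<longrightarrow>
            injective_on_operad ComMag \<phi>)"
proof (intro conjI exI allI impI)
  show "operad_morphism ComMag NAP (\<lambda>_. symmetrization :: (nat, 'k) free_commag \<Rightarrow> _)"
    by (rule operad_morphism_symmetrization)
  show "symmetrization (commag_gen 1 \<odot> commag_gen 2)
      = (nap_gen 1 \<star> nap_gen 2 + nap_gen 2 \<star> nap_gen 1 :: (nat, 'k) free_nap)"
    by (rule symmetrization_generator)
next
  fix \<phi> :: "nat set \<Rightarrow> (nat, 'k) free_commag \<Rightarrow> (nat, 'k) free_nap"
  assume \<phi>: "operad_morphism ComMag NAP \<phi>"
    "\<phi> {1, 2} (commag_gen 1 \<odot> commag_gen 2) = nap_gen 1 \<star> nap_gen 2 + nap_gen 2 \<star> nap_gen 1"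
  have "inj_on (\<phi> {1..n}) (comps ComMag {1..n})" if "1 \<le> n" for n
  proof -
    have "labels {1..n}" using that by (simp add: labels_def)
    from morphism_eq_symmetrization[OF \<phi> this] show ?thesis
      using inj_on_cong[of "comps ComMag {1..n}" "\<phi> {1..n}" symmetrization] inj_on_symmetrization
      by blast
  qed
  then show "injective_on_operad ComMag \<phi>"
    by (simp add: injective_on_operad_def)
qed

end
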